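(* Let $c>0$ and $p>0$. For integers $n>p$, let $A_n$ be the adjacency matrix of a random graph following $\mathrm{G}(n,p/n)$, and let $K_n=D_n^{-1}A_n$, where $D_n$ is the diagonal matrix whose $i$-th diagonal entry is $c+\sum_{j=1}^n(A_n)_{ij}$. Let $\mu_\infty$ be the limiting distribution, as $n\to\infty$, of the empirical spectral distribution of $K_n$ (weak convergence in probability), and let $\beta_k$ denote the $k$-th moment of $\mu_\infty$. Then for every even $k=2m$ with $m\ge1$ an integer, $$\beta_k=\sum_{t=2}^{m+1}p^{t-1}\sum_{\boldsymbol{i}\in\Gamma_{k,t}}\ \prod_{a=1}^t\mathrm{E}\left[\left(c+d(a,[\boldsymbol{i}])+\xi\right)^{-n_+(a,\boldsymbol{i})}\right],$$ where $\xi$ is a Poisson random variable with mean $p$.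
   Context: $\mathrm{G}(n,a)$, for $a\in[0,1]$, denotes the Erdős–Rényi distribution on simple graphs with vertex set $\{1,\dots,n\}$ in which each pair of distinct vertices is joined by an edge with probability $a$, independently of the other pairs. The adjacency matrix has $(i,j)$ entry $1$ if $\{i,j\}$ is an edge and $0$ otherwise. For an $n\times n$ matrix $M$ with eigenvalues $\lambda_1(M),\dots,\lambda_n(M)$ (counted with multiplicity), its empirical spectral distribution is $n^{-1}\sum_{i=1}^n\delta_{\lambda_i(M)}$; the eigenvalues of $K_n$ are real. It is known that the empirical spectral distribution of $K_n$ converges weakly in probability to a nonrandom probability measure $\mu_\infty$, whose $k$-th moment, for each integer $k\ge1$, is $\beta_k=\mathrm{E}\,r_k(T,\emptyset,c)$, where $T$ is a Galton–Watson tree rooted at $\emptyset$ with Poisson offspring distribution of mean $p$, and $r_k$ is defined as follows. For a (locally finite, simple) graph $G$ with vertex $v_0$, consider a random walk on $G$ from $v_0$ at step $0$: if $v_0$ has degree at least $1$, then whenever the walk is alive at a vertex $v$ of degree $d$, at the next step it moves to each given neighbor of $v$ with probability $1/(c+d)$, or is killed with probability $c/(c+d)$; if $v_0$ has degree $0$, the walk is killed at step $1$. Then $r_k(G,v_0,c)$ is the probability that the walk is alive and at $v_0$ at step $k$. Path notation. A path of length $k\ge1$ on a finite set $I$ is a sequence $\boldsymbol{v}=(v_1,\dots,v_{k+1})$ with all $v_i\in I$ and $v_i\ne v_{i+1}$ for $1\le i\le k$ (vertices may otherwise repeat); it is closed if $v_{k+1}=v_1$. $C_{k,n}$ is the set of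 closed paths of length $k$ on $\{1,\dots,n\}$. For a path $\boldsymbol{v}$, $[\boldsymbol{v}]$ is the graph whose vertex set consists of the distinct elements among the $v_i$ and whose edge set consists of the distinct unordered pairs among $\{v_i,v_{i+1}\}$, $1\le i\le k$. $n_+(u,\boldsymbol{v})$ is the number of indices $1\le i\le k$ with $v_i=u$, i.e. the number of directed edges $(v_i,v_{i+1})$ of $\boldsymbol{v}$ starting at $u$, counted with multiplicity. $d(a,[\boldsymbol{i}])$ is the degree of $a$ in the graph $[\boldsymbol{i}]$. A path $\boldsymbol{i}=(i_1,\dots,i_{k+1})\in C_{k,n}$ is canonical if $i_1=1$ and $i_j\le\max(i_1,\dots,i_{j-1})+1$ for $2\le j\le k$. $\Gamma_{k,t}$ is the set of canonical $\boldsymbol{i}\in C_{k,n}$ such that $[\boldsymbol{i}]$ is a tree with exactly $t$ vertices (so its vertex set is $\{1,\dots,t\}$); this is independent of $n$ as long as $n\ge t$. *)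

theory Defs
  imports
    "HOL-Probability.Probability"
    "Jordan_Normal_Form.Gauss_Jordan_Elimination"
    "Jordan_Normal_Form.Char_Poly"
begin

section \<open>Simple graphs\<close>

type_synonym 'a sgraph = "'a set \<times> 'a set set"

definition degree_in :: "'a \<Rightarrow> 'a sgraph \<Rightarrow> nat" where
  "degree_in a G = card {e \<in> snd G. a \<in> e}"

definition graph_connected :: "'a sgraph \<Rightarrow> bool" where
  "graph_connected G \<longleftrightarrow> fst G \<noteq> {} \<and>
     (\<forall>u\<in>fst G. \<forall>v\<in>fst G. (u, v) \<in> {(x, y). {x, y} \<in> snd G}\<^sup>*)"

definition graph_cycle :: "'a sgraph \<Rightarrow> 'a list \<Rightarrow> bool" where
  "graph_cycle G ws \<longleftrightarrow> length ws \<ge> 3 \<and> distinct ws \<and>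
     (\<forall>i. Suc i < length ws \<longrightarrow> {ws ! i, ws ! Suc i} \<in> snd G) \<and> {last ws, hd ws} \<in> snd G"

definition is_tree :: "'a sgraph \<Rightarrow> bool" where
  "is_tree G \<longleftrightarrow> graph_connected G \<and> (\<nexists>ws. graph_cycle G ws)"


section \<open>Paths\<close>

text \<open>A path of length \<open>k\<close> is a list with \<open>k + 1\<close> entries; list positions count from \<open>0\<close>, so
  \<open>v ! i\<close> is the entry usually written \<open>v\<^sub>i\<^sub>+\<^sub>1\<close>.\<close>

definition is_path :: "'a set \<Rightarrow> nat \<Rightarrow> 'a list \<Rightarrow> bool" where
  "is_path I k v \<longleftrightarrow> k \<ge> 1 \<and> length v = Suc k \<and> set v \<subseteq> I \<and> (\<forall>i<k. v ! i \<noteq> v ! Suc i)"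

definition closed_paths :: "nat \<Rightarrow> nat \<Rightarrow> nat list set" where
  "closed_paths k n = {v. is_path {1..n} k v \<and> v ! k = v ! 0}"

definition path_graph :: "'a list \<Rightarrow> 'a sgraph" where
  "path_graph v = (set v, {{v ! i, v ! Suc i} | i. Suc i < length v})"

definition n_plus :: "'a \<Rightarrow> 'a list \<Rightarrow> nat" where
  "n_plus u v = card {i. Suc i < length v \<and> v ! i = u}"

definition canonical :: "nat list \<Rightarrow> bool" where
  "canonical v \<longleftrightarrow> v ! 0 = 1 \<and>
     (\<forall>j. 1 \<le> j \<and> j < length v \<longrightarrow> v ! j \<le> Max {v ! i | i. i < j} + 1)"

definition canonical_tree_paths :: "nat \<Rightarrow> nat \<Rightarrow> nat \<Rightarrow> nat list set" where
  "canonical_tree_paths n k t =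
     {v \<in> closed_paths k n. canonical v \<and> is_tree (path_graph v) \<and> card (fst (path_graph v)) = t}"

text \<open>The set does not depend on \<open>n\<close> as long as \<open>n \<ge> t\<close> (lemma \<open>canonical_tree_paths_eq_Gamma_paths\<close>
  below), so we take \<open>n = t\<close>.\<close>

definition Gamma_paths :: "nat \<Rightarrow> nat \<Rightarrow> nat list set" where
  "Gamma_paths k t = canonical_tree_paths t k t"

lemma canonical_prefix:
  assumes v: "canonical v" "set v \<subseteq> {1..n}" and j: "1 \<le> j" "j \<le> length v"
  shows "{v ! i | i. i < j} = {1..card {v ! i | i. i < j}}"
  using j
proof (induction j rule: nat_induct_at_least)
  case base
  have "{v ! i | i. i < 1} = {1}" using v(1) by (auto simp: canonical_def)
  then show ?case by simp
next
  case (Suc j)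
  define S where "S = {v ! i | i. i < j}"
  have S: "S = {1..card S}" using Suc by (simp add: S_def)
  have "v ! 0 \<in> S" using Suc.hyps by (auto simp: S_def)
  with S have c: "1 \<le> card S" by (metis atLeastAtMost_iff order.trans)
  have "Max {1..card S} = card S" using c by (intro Max_eqI) auto
  with S have "Max S = card S" by simp
  then have le: "v ! j \<le> card S + 1"
    using v(1) Suc by (auto simp: canonical_def S_def)
  have ge: "1 \<le> v ! j" using v(2) Suc.prems nth_mem[of j v] by fastforce
  have ins: "{v ! i | i. i < Suc j} = insert (v ! j) S"
    by (auto simp: S_def less_Suc_eq)
  show ?case
  proof (cases "v ! j \<in> S")
    case True
    then show ?thesis using ins S by (simp add: insert_absorb)
  next
    case False
    then have vj: "v ! j = Suc (card S)" using S le ge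
      by (metis Suc_eq_plus1 atLeastAtMost_iff le_SucE)
    have fin: "finite S" by (metis S finite_atLeastAtMost)
    have "insert (v ! j) S = {1..Suc (card S)}"
      using S vj by (metis atLeastAtMostSuc_conv c le_SucI)
    moreover have "card (insert (v ! j) S) = Suc (card S)" using False fin by simp
    ultimately show ?thesis using ins by simp
  qed
qed

lemma canonical_tree_paths_eq_Gamma_paths:
  assumes "t \<le> n"
  shows "canonical_tree_paths n k t = Gamma_paths k t"
proof -
  have "set v = {1..t}"
    if "v \<in> closed_paths k n'" "canonical v" "card (set v) = t" for v n'
  proof -
    have "set v = {v ! i | i. i < length v}" by (auto simp: in_set_conv_nth)
    then show ?thesis
      using canonical_prefix[of v n' "length v"] that
      by (auto simp: closed_paths_def is_path_def)
  qed
  then show ?thesis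
    using assms
    unfolding Gamma_paths_def canonical_tree_paths_def closed_paths_def is_path_def path_graph_def
    by fastforce
qed


section \<open>Erdos-Renyi random graphs and the matrix of the killed random walk\<close>

definition erdos_renyi :: "nat \<Rightarrow> real \<Rightarrow> nat sgraph pmf" where
  "erdos_renyi n a =
     (let P = {e. e \<subseteq> {1..n} \<and> card e = 2}
      in map_pmf (\<lambda>f. ({1..n}, {e \<in> P. f e})) (Pi_pmf P False (\<lambda>_. bernoulli_pmf a)))"

text \<open>Matrix indices start at \<open>0\<close>, vertices at \<open>1\<close>.\<close>

definition adjacency_mat :: "nat \<Rightarrow> nat sgraph \<Rightarrow> real mat" where
  "adjacency_mat n G = Matrix.mat n n (\<lambda>(i, j). if {Suc i, Suc j} \<in> snd G then 1 else 0)"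

definition shifted_degree_mat :: "real \<Rightarrow> nat \<Rightarrow> nat sgraph \<Rightarrow> real mat" where
  "shifted_degree_mat c n G = mat_diag n (\<lambda>i. c + (\<Sum>j<n. adjacency_mat n G $$ (i, j)))"

definition walk_mat :: "real \<Rightarrow> nat \<Rightarrow> nat sgraph \<Rightarrow> real mat" where
  "walk_mat c n G = the (mat_inverse (shifted_degree_mat c n G)) * adjacency_mat n G"

lemma mat_inverse_shifted_degree_mat:
  assumes "c > 0"
  shows "mat_inverse (shifted_degree_mat c n G) =
    Some (mat_diag n (\<lambda>i. inverse (c + (\<Sum>j<n. adjacency_mat n G $$ (i, j)))))"
proof -
  define d where "d = (\<lambda>i. c + (\<Sum>j<n. adjacency_mat n G $$ (i, j)))"
  have pos: "d i > 0" if "i < n" for i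
    unfolding d_def using assms that
    by (intro add_pos_nonneg sum_nonneg) (auto simp: adjacency_mat_def)
  define D where "D = mat_diag n d"
  define E where "E = mat_diag n (\<lambda>i. inverse (d i))"
  have D: "D \<in> carrier_mat n n" and E: "E \<in> carrier_mat n n" by (simp_all add: D_def E_def)
  have "D * E = mat_diag n (\<lambda>i. d i * inverse (d i))"
    "E * D = mat_diag n (\<lambda>i. inverse (d i) * d i)"
    by (simp_all add: D_def E_def)
  moreover have "mat_diag n (\<lambda>i. d i * inverse (d i)) = 1\<^sub>m n"
    "mat_diag n (\<lambda>i. inverse (d i) * d i) = 1\<^sub>m n"
    using pos by (intro eq_matI; force simp: mat_diag_def)+
  ultimately have DE: "D * E = 1\<^sub>m n" "E * D = 1\<^sub>m n" by simp_all
  have "D \<in> Units (ring_mat TYPE(real) n undefined)"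
    using D E DE by (auto simp: Units_def ring_mat_def)
  then obtain B where B: "mat_inverse D = Some B"
    using mat_inverse(1)[OF D, of undefined] by (cases "mat_inverse D") auto
  then have "D * B = 1\<^sub>m n" "B \<in> carrier_mat n n" using mat_inverse(2)[OF D] by auto
  then have "B = E"
    using DE E D by (metis assoc_mult_mat left_mult_one_mat right_mult_one_mat)
  with B show ?thesis by (simp add: D_def E_def d_def shifted_degree_mat_def)
qed


section \<open>Empirical spectral distributions and their convergence\<close>

text \<open>The complex characteristic polynomial of an \<open>n \<times> n\<close> matrix has \<open>n\<close> roots counted with
  multiplicity. Taking real parts is the identity for matrices all of whose eigenvalues are real,
  such as \<open>walk_mat c n G\<close>; only for those is this meant to be used.\<close>

definition esd :: "real mat \<Rightarrow> real pmf" where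
  "esd M = pmf_of_multiset (image_mset Re (proots (char_poly (map_mat complex_of_real M))))"

definition weak_conv_in_prob ::
    "(nat \<Rightarrow> 'a pmf) \<Rightarrow> (nat \<Rightarrow> 'a \<Rightarrow> real measure) \<Rightarrow> real measure \<Rightarrow> bool" where
  "weak_conv_in_prob P M \<mu> \<longleftrightarrow>
     (\<forall>f :: real \<Rightarrow> real. continuous_on UNIV f \<and> bounded (range f) \<longrightarrow>
       (\<forall>\<epsilon>>0. (\<lambda>n. measure_pmf.prob (P n)
                   {\<omega>. \<bar>(LINT x|M n \<omega>. f x) - (LINT x|\<mu>. f x)\<bar> > \<epsilon>}) \<longlonglongrightarrow> 0))"

text \<open>Only \<open>n > p\<close> is meaningful here; the finitely many \<open>n \<le> p\<close> do not affect the limit.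
  Convergence in probability depends only on the law of each single graph, so no joint
  distribution of the graphs for different \<open>n\<close> is needed.\<close>

definition limiting_esd :: "real \<Rightarrow> real \<Rightarrow> real measure \<Rightarrow> bool" where
  "limiting_esd c p \<mu> \<longleftrightarrow> real_distribution \<mu> \<and>
     weak_conv_in_prob (\<lambda>n. erdos_renyi n (p / real n))
       (\<lambda>n G. measure_pmf (esd (walk_mat c n G))) \<mu>"

end

theory Submission
  imports Defs "Jordan_Normal_Form.Schur_Decomposition" "HOL-Real_Asymp.Real_Asymp"
begin

text \<open>The argument is a direct moment computation and never meets the Galton-Watson tree. The
  eigenvalues of \<open>D\<^sup>-\<^sup>1A\<close> are real and lie in \<open>[-1, 1]\<close>, so \<open>\<mu>\<close> lives on \<open>[-1, 1]\<close>, \<open>x\<^sup>k\<close> may be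
  truncated to a bounded continuous function, and the \<open>k\<close>-th moment is the limit of the expected
  normalised trace of the \<open>k\<close>-th power. That trace is a sum over closed paths; the law of the graph is
  invariant under permutations of the vertices, so only the canonical representative of a path and the
  number \<open>n(n-1)\<dots>(n-t+1)\<close> of its relabellings matter. The edges of a path with \<open>t\<close> vertices and
  \<open>e \<ge> t - 1\<close> edges are all present with probability \<open>(p/n)\<^sup>e\<close>, so only trees (\<open>e = t - 1\<close>) survive in the
  limit. The remaining edges at the vertices of the path go, up to edges inside the path, to disjoint
  sets of pairs, and their numbers are asymptotically independent Poisson variables. Finally a closed
  path on a tree uses every edge at least twice, whence \<open>t \<le> m + 1\<close>.\<close>

section \<open>Spectrum of the matrix of the killed walk\<close>

text \<open>Weak convergence in probability controls only bounded continuous test functions, whereas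
  \<open>x ^ k\<close> is unbounded. The moment becomes reachable because the interval that contains
  the spectrum depends neither on \<open>n\<close> nor on the graph. As \<open>\<mu>\<close> is
  given, neither the existence of the limit nor the question whether moments determine a measure has
  to be settled. The other obstacle is dependence. The degrees of two path vertices share the pair
  that joins them, so their inverse powers are not independent for finite \<open>n\<close>. The
  weight of a path is therefore squeezed between two products over disjoint sets of pairs. Their
  expectations differ by a power of \<open>1 - p / n\<close> whose exponent is fixed once the path
  is fixed, and this factor tends to 1.\<close>

lemma trace_mult_commute:
  fixes A B :: "'a :: comm_semiring_0 mat"
  assumes "A \<in> carrier_mat n m" "B \<in> carrier_mat m n"
  shows "(\<Sum>i<n. (A * B) $$ (i, i)) = (\<Sum>i<m. (B * A) $$ (i, i))"
proof -
  have "(\<Sum>i<n. (A * B) $$ (i, i)) = (\<Sum>i<n. \<Sum>j<m. A $$ (i, j) * B $$ (j, i))"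
    using assms by (intro sum.cong) (auto simp: scalar_prod_def atLeast0LessThan intro!: sum.cong)
  also have "\<dots> = (\<Sum>j<m. \<Sum>i<n. B $$ (j, i) * A $$ (i, j))"
    by (subst sum.swap) (simp add: mult.commute)
  also have "\<dots> = (\<Sum>i<m. (B * A) $$ (i, i))"
    using assms by (intro sum.cong) (auto simp: scalar_prod_def atLeast0LessThan intro!: sum.cong)
  finally show ?thesis .
qed

text \<open>Both claims need one joint induction: in the sum over \<open>l\<close>, a term left of
  the diagonal is killed by the induction hypothesis for the power, and a term right of it by the
  triangularity of \<open>B\<close>.\<close>

lemma upper_triangular_pow:
  fixes B :: "'a :: comm_ring_1 mat"
  assumes B: "B \<in> carrier_mat n n" "upper_triangular B"
  shows "(\<forall>i<n. \<forall>j<i. (B ^\<^sub>m k) $$ (i, j) = 0) \<and> (\<forall>i<n. (B ^\<^sub>m k) $$ (i, i) = (B $$ (i, i)) ^ k)"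
proof (induction k)
  case 0
  then show ?case using B by auto
next
  case (Suc k)
  have dim: "B ^\<^sub>m k \<in> carrier_mat n n" using B by simp
  have Bz: "B $$ (i, j) = 0" if "j < i" "i < n" for i j
    using B that by (auto simp: upper_triangular_def)
  have entry: "(B ^\<^sub>m Suc k) $$ (i, j) = (\<Sum>l<n. (B ^\<^sub>m k) $$ (i, l) * B $$ (l, j))"
    if "i < n" "j < n" for i j
    using that B dim by (auto simp: scalar_prod_def atLeast0LessThan intro!: sum.cong)
  show ?case
  proof (intro conjI allI impI)
    fix i j assume ij: "i < n" "j < i"
    have "(B ^\<^sub>m k) $$ (i, l) * B $$ (l, j) = 0" if "l < n" for l
    proof (cases "l < i")
      case True
      then show ?thesis using Suc ij by simp
    next
      case False
      then have "B $$ (l, j) = 0" using ij that by (intro Bz) auto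
      then show ?thesis by simp
    qed
    then have "(\<Sum>l<n. (B ^\<^sub>m k) $$ (i, l) * B $$ (l, j)) = 0"
      by (intro sum.neutral) auto
    then show "(B ^\<^sub>m Suc k) $$ (i, j) = 0" using entry[of i j] ij by simp
  next
    fix i assume i: "i < n"
    have "(B ^\<^sub>m k) $$ (i, l) * B $$ (l, i) = 0" if "l < n" "l \<noteq> i" for l
    proof (cases "l < i")
      case True
      then show ?thesis using Suc i by simp
    next
      case False
      then have "B $$ (l, i) = 0" using i that by (intro Bz) auto
      then show ?thesis by simp
    qed
    then have "(\<Sum>l<n. (B ^\<^sub>m k) $$ (i, l) * B $$ (l, i)) =
        (\<Sum>l\<in>{i}. (B ^\<^sub>m k) $$ (i, l) * B $$ (l, i))"
      using i by (intro sum.mono_neutral_right) auto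
    then show "(B ^\<^sub>m Suc k) $$ (i, i) = B $$ (i, i) ^ Suc k"
      using entry[of i i] i Suc by (simp add: mult.commute)
  qed
qed

lemma proots_linear_factors:
  "proots (\<Prod>a\<leftarrow>as. [:- a, 1:]) = mset (as :: 'a :: idom list)"
proof (induction as)
  case (Cons a as)
  have "(\<Prod>a\<leftarrow>as. [:- a, 1:]) \<noteq> (0 :: 'a poly)" by (auto simp: prod_list_zero_iff)
  then have "proots ([:- a, 1:] * (\<Prod>a\<leftarrow>as. [:- a, 1:])) =
      proots [:- a, 1:] + proots (\<Prod>a\<leftarrow>as. [:- a, 1:])" by (intro proots_mult) auto
  then show ?case using Cons by simp
qed simp

text \<open>Schur triangularisation replaces diagonalisation: \<open>A\<close> is similar to a
  triangular \<open>B\<close> whose diagonal lists the roots with multiplicity, powers of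
  \<open>B\<close> have powers on the diagonal, and similarity preserves the trace.\<close>

lemma trace_pow_eq_sum_eigenvalues:
  fixes A :: "complex mat"
  assumes A: "A \<in> carrier_mat n n"
  shows "(\<Sum>i<n. (A ^\<^sub>m k) $$ (i, i)) = (\<Sum>x\<in>#proots (char_poly A). x ^ k)"
proof -
  obtain as where as: "char_poly A = (\<Prod>a\<leftarrow>as. [:- a, 1:])"
    using char_poly_factorized[OF A] by blast
  obtain B where B: "B \<in> carrier_mat n n" "upper_triangular B" "similar_mat A B"
    using schur_decomposition_exists[OF A as] by blast
  obtain P Q where wit: "similar_mat_wit A B P Q"
    using B(3) by (auto simp: similar_mat_def)
  have PQ: "P \<in> carrier_mat n n" "Q \<in> carrier_mat n n" "Q * P = 1\<^sub>m n"
    using similar_mat_witD2[OF A wit] by auto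
  have Bk: "B ^\<^sub>m k \<in> carrier_mat n n" using B by simp
  have "(\<Sum>i<n. (A ^\<^sub>m k) $$ (i, i)) = (\<Sum>i<n. (P * B ^\<^sub>m k * Q) $$ (i, i))"
    by (simp add: similar_mat_wit_pow_id[OF wit, of k])
  also have "\<dots> = (\<Sum>i<n. (Q * (P * B ^\<^sub>m k)) $$ (i, i))"
    using PQ Bk by (intro trace_mult_commute) auto
  also have "Q * (P * B ^\<^sub>m k) = B ^\<^sub>m k"
    using PQ(3) Bk assoc_mult_mat[OF PQ(2,1) Bk] left_mult_one_mat[OF Bk] by metis
  also have "(\<Sum>i<n. (B ^\<^sub>m k) $$ (i, i)) = (\<Sum>i<n. (B $$ (i, i)) ^ k)"
    using upper_triangular_pow[OF B(1,2), of k] by (intro sum.cong) auto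
  also have "\<dots> = (\<Sum>x\<leftarrow>diag_mat B. x ^ k)"
    using B(1) by (simp add: diag_mat_def sum_list_distinct_conv_sum_set atLeast0LessThan comp_def)
  also have "\<dots> = (\<Sum>x\<in>#mset (diag_mat B). x ^ k)"
    by (simp flip: sum_mset_sum_list)
  also have "mset (diag_mat B) = proots (char_poly A)"
    by (simp add: char_poly_similar[OF B(3)] char_poly_upper_triangular[OF B(1,2)]
        proots_linear_factors)
  finally show ?thesis .
qed

lemma walk_mat_eq:
  assumes "c > 0"
  shows "walk_mat c n G = Matrix.mat n n (\<lambda>(i, j).
    adjacency_mat n G $$ (i, j) / (c + (\<Sum>l<n. adjacency_mat n G $$ (i, l))))"
proof -
  have "adjacency_mat n G \<in> carrier_mat n n" by (simp add: adjacency_mat_def)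
  then show ?thesis
    unfolding walk_mat_def mat_inverse_shifted_degree_mat[OF assms] option.sel
    by (subst mat_diag_mult_left) (auto simp: divide_inverse intro!: eq_matI)
qed

text \<open>\<open>walk_mat\<close> is in general not symmetric, but it is self-adjoint for the
  inner product with weights \<open>d i\<close>, which are positive because \<open>c > 0\<close>.
  Complex eigenvectors are considered since \<open>esd\<close> starts from complex roots.\<close>

lemma walk_mat_eigenvalue:
  assumes c: "c > 0" and ev: "eigenvalue (map_mat complex_of_real (walk_mat c n G)) z"
  shows "Im z = 0" "\<bar>Re z\<bar> \<le> 1"
proof -
  define a where "a i j = adjacency_mat n G $$ (i, j)" for i j
  define d where "d i = c + (\<Sum>l<n. a i l)" for i
  have a_nn: "a i j \<ge> 0" if "i < n" "j < n" for i j
    using that by (simp add: a_def adjacency_mat_def)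
  have a_sym: "a i j = a j i" if "i < n" "j < n" for i j
    using that by (simp add: a_def adjacency_mat_def insert_commute)
  have d_pos: "d i > 0" if "i < n" for i
    unfolding d_def using c a_nn that by (intro add_pos_nonneg sum_nonneg) auto
  obtain x where x: "x \<in> carrier_vec n" "x \<noteq> 0\<^sub>v n"
    "map_mat complex_of_real (walk_mat c n G) *\<^sub>v x = z \<cdot>\<^sub>v x"
    using ev by (auto simp: eigenvalue_def eigenvector_def walk_mat_eq[OF c])
  have eq: "(\<Sum>j<n. of_real (a i j) * x $ j) = z * of_real (d i) * x $ i" if i: "i < n" for i
  proof -
    have "(map_mat complex_of_real (walk_mat c n G) *\<^sub>v x) $ i =
        (\<Sum>j<n. of_real (a i j / d i) * x $ j)"
      using i x(1) by (auto simp: walk_mat_eq[OF c] scalar_prod_def a_def d_def atLeast0LessThan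
          intro!: sum.cong)
    also have "\<dots> = (\<Sum>j<n. of_real (a i j) * x $ j) / of_real (d i)"
      by (simp add: sum_divide_distrib)
    finally have "(\<Sum>j<n. of_real (a i j) * x $ j) / of_real (d i) = z * x $ i"
      using x(1,3) i by simp
    then show ?thesis using d_pos[OF i] by (simp add: field_simps)
  qed
  obtain r where r: "r < n" "x $ r \<noteq> 0"
  proof -
    have "\<exists>r<n. x $ r \<noteq> 0"
    proof (rule ccontr)
      assume "\<not> (\<exists>r<n. x $ r \<noteq> 0)"
      then have "x = 0\<^sub>v n" using x(1) by (intro eq_vecI) auto
      with x(2) show False by simp
    qed
    then show ?thesis using that by blast
  qed
  define S where "S = (\<Sum>i<n. d i * (cmod (x $ i))\<^sup>2)"
  have "S > 0"
    unfolding S_def using r d_pos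
    by (intro sum_pos2[of _ r]) (auto intro!: mult_nonneg_nonneg d_pos[THEN less_imp_le])
  \<comment> \<open>\<open>A x = z D x\<close> gives \<open>x\<^sup>* A x = z x\<^sup>* D x\<close>, and both quadratic forms are real.\<close>
  define T where "T = (\<Sum>i<n. \<Sum>j<n. of_real (a i j) * cnj (x $ i) * x $ j)"
  have "T = (\<Sum>i<n. cnj (x $ i) * (\<Sum>j<n. of_real (a i j) * x $ j))"
    unfolding T_def by (simp add: sum_distrib_left mult_ac)
  also have "\<dots> = (\<Sum>i<n. z * of_real (d i * (cmod (x $ i))\<^sup>2))"
  proof (intro sum.cong refl)
    fix i assume "i \<in> {..<n}"
    then show "cnj (x $ i) * (\<Sum>j<n. of_real (a i j) * x $ j) =
        z * of_real (d i * (cmod (x $ i))\<^sup>2)"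
      unfolding of_real_mult complex_norm_square by (subst eq) (auto simp: mult_ac)
  qed
  also have "\<dots> = z * of_real S" by (simp add: S_def sum_distrib_left)
  finally have T: "T = z * of_real S" .
  have "cnj T = (\<Sum>i<n. \<Sum>j<n. of_real (a i j) * x $ i * cnj (x $ j))"
    unfolding T_def by simp
  also have "\<dots> = (\<Sum>j<n. \<Sum>i<n. of_real (a i j) * x $ i * cnj (x $ j))"
    by (rule sum.swap)
  also have "\<dots> = T"
    unfolding T_def by (intro sum.cong refl) (auto simp: a_sym mult_ac)
  finally have "Im T = 0" by (metis cnj.simps(2) equal_neg_zero)
  then show "Im z = 0" using T \<open>S > 0\<close> by simp
  \<comment> \<open>Rows sum to less than 1: compare at a coordinate of maximal modulus.\<close>
  have "Max ((\<lambda>i. cmod (x $ i)) ` {..<n}) \<in> (\<lambda>i. cmod (x $ i)) ` {..<n}"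
    using r by (intro Max_in) auto
  then obtain q where qn: "q < n" and "cmod (x $ q) = Max ((\<lambda>i. cmod (x $ i)) ` {..<n})" by auto
  then have q: "cmod (x $ i) \<le> cmod (x $ q)" if "i < n" for i
    using that by (auto intro!: Max_ge)
  have xq: "cmod (x $ q) > 0" using q[OF r(1)] r(2) by (meson less_le_trans zero_less_norm_iff)
  have "cmod z * d q * cmod (x $ q) = cmod (\<Sum>j<n. of_real (a q j) * x $ j)"
    using d_pos[OF qn] by (simp add: eq[OF qn] norm_mult)
  also have "\<dots> \<le> (\<Sum>j<n. cmod (of_real (a q j) * x $ j))" by (rule norm_sum)
  also have "\<dots> \<le> (\<Sum>j<n. a q j * cmod (x $ q))"
    using a_nn qn q by (intro sum_mono) (auto simp: norm_mult intro!: mult_left_mono)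
  also have "\<dots> \<le> d q * cmod (x $ q)"
    unfolding d_def using c xq by (simp add: sum_distrib_right[symmetric] mult_right_mono)
  finally have "cmod z * (d q * cmod (x $ q)) \<le> 1 * (d q * cmod (x $ q))" by (simp add: mult_ac)
  then have "cmod z \<le> 1" using xq d_pos[OF qn] by (simp add: mult_le_cancel_right)
  then show "\<bar>Re z\<bar> \<le> 1" using abs_Re_le_cmod order_trans by blast
qed

section \<open>Moments of the empirical spectral distribution as normalised traces\<close>

lemma sum_mset_conv_count:
  fixes f :: "'a \<Rightarrow> real"
  shows "(\<Sum>x\<in>#M. f x) = (\<Sum>x\<in>set_mset M. count M x * f x)"
proof (induction M)
  case (add a M)
  have "(\<Sum>x\<in>set_mset (add_mset a M). count (add_mset a M) x * f x) =
      (\<Sum>x\<in>insert a (set_mset M). (if x = a then f x else 0) + count M x * f x)"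
    by (intro sum.cong) (auto simp: algebra_simps)
  also have "\<dots> = f a + (\<Sum>x\<in>insert a (set_mset M). count M x * f x)"
    by (simp add: sum.distrib sum.delta)
  also have "(\<Sum>x\<in>insert a (set_mset M). count M x * f x) = (\<Sum>x\<in>set_mset M. count M x * f x)"
    by (intro sum.mono_neutral_right) (auto simp: not_in_iff)
  finally show ?case using add by simp
qed simp

lemma expectation_pmf_of_multiset:
  fixes f :: "'a \<Rightarrow> real"
  assumes "M \<noteq> {#}"
  shows "measure_pmf.expectation (pmf_of_multiset M) f = (\<Sum>x\<in>#M. f x) / size M"
proof -
  have "measure_pmf.expectation (pmf_of_multiset M) f =
      (\<Sum>x\<in>set_mset M. count M x * f x) / size M"
    using assms by (subst integral_measure_pmf[of "set_mset M"])
      (auto simp: sum_divide_distrib mult_ac)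
  also have "(\<Sum>x\<in>set_mset M. count M x * f x) = (\<Sum>x\<in>#M. f x)"
    by (simp add: sum_mset_conv_count)
  finally show ?thesis .
qed

text \<open>\<open>esd\<close> takes real parts before any power is formed, so the trace identity
  applies only because all roots are real, where \<open>Re x ^ k\<close> and \<open>x ^ k\<close>
  agree. With \<open>n > 0\<close> the multiset of roots is nonempty, and
  \<open>pmf_of_multiset\<close> is the uniform average over it.\<close>

lemma esd_walk_mat:
  fixes f :: "real \<Rightarrow> real"
  assumes c: "c > 0" and n: "n > 0"
  shows "set_pmf (esd (walk_mat c n G)) \<subseteq> {-1..1}" 
    and "measure_pmf.expectation (esd (walk_mat c n G)) (\<lambda>x. x ^ k) =
      (\<Sum>i<n. (walk_mat c n G ^\<^sub>m k) $$ (i, i)) / n"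
proof -
  define W where "W = map_mat complex_of_real (walk_mat c n G)"
  have wc: "walk_mat c n G \<in> carrier_mat n n" by (simp add: walk_mat_eq[OF c])
  have W: "W \<in> carrier_mat n n" by (simp add: W_def walk_mat_eq[OF c])
  define R where "R = proots (char_poly W)"
  have ev: "Im z = 0" "\<bar>Re z\<bar> \<le> 1" if "z \<in># R" for z
  proof -
    have "char_poly W \<noteq> 0" using degree_monic_char_poly[OF W] by auto
    then have "poly (char_poly W) z = 0" using that by (simp add: R_def)
    then have "eigenvalue W z" using eigenvalue_root_char_poly[OF W] by simp
    then show "Im z = 0" "\<bar>Re z\<bar> \<le> 1" unfolding W_def using walk_mat_eigenvalue[OF c] by auto
  qed
  have size: "size R = n"
    using degree_monic_char_poly[OF W] by (simp add: R_def size_proots_complex)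
  then have ne: "image_mset Re R \<noteq> {#}" using n by auto
  have esd: "esd (walk_mat c n G) = pmf_of_multiset (image_mset Re R)"
    by (simp add: esd_def R_def W_def)
  show "set_pmf (esd (walk_mat c n G)) \<subseteq> {-1..1}" 
    unfolding esd set_pmf_of_multiset[OF ne] using ev(2) by (auto simp: abs_le_iff)
  have "complex_of_real (\<Sum>x\<in>#R. Re x ^ k) = (\<Sum>x\<in>#R. of_real (Re x ^ k))"
    by (induction R) auto
  also have "\<dots> = (\<Sum>x\<in>#R. x ^ k)"
    using ev(1) by (intro arg_cong[of _ _ sum_mset] image_mset_cong) (auto simp: complex_eq_iff simp flip: of_real_power)
  also have "\<dots> = (\<Sum>i<n. (W ^\<^sub>m k) $$ (i, i))"
    unfolding R_def using trace_pow_eq_sum_eigenvalues[OF W] by simp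
  also have "W ^\<^sub>m k = map_mat complex_of_real (walk_mat c n G ^\<^sub>m k)"
    unfolding W_def by (simp add: of_real_hom.mat_hom_pow[OF wc])
  also have "(\<Sum>i<n. map_mat complex_of_real (walk_mat c n G ^\<^sub>m k) $$ (i, i)) =
      complex_of_real (\<Sum>i<n. (walk_mat c n G ^\<^sub>m k) $$ (i, i))"
    using wc by (auto intro!: sum.cong)
  finally have "(\<Sum>x\<in>#R. Re x ^ k) = (\<Sum>i<n. (walk_mat c n G ^\<^sub>m k) $$ (i, i))"
    using of_real_eq_iff by blast
  then show "measure_pmf.expectation (esd (walk_mat c n G)) (\<lambda>x. x ^ k) =
      (\<Sum>i<n. (walk_mat c n G ^\<^sub>m k) $$ (i, i)) / n"
    unfolding esd by (simp add: expectation_pmf_of_multiset[OF ne] size image_mset.compositionality comp_def)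
qed

section \<open>Trees and closed paths\<close>

abbreviation path_edges :: "'a list \<Rightarrow> 'a set set" where
  "path_edges v \<equiv> snd (path_graph v)"

lemma path_edges_eq_image: "path_edges v = (\<lambda>i. {v ! i, v ! Suc i}) ` {..<length v - 1}"
  by (auto simp: path_graph_def)

lemma path_edges_snoc:
  assumes "v \<noteq> []"
  shows "path_edges (v @ [x]) = insert {last v, x} (path_edges v)"
proof -
  obtain m where m: "length v = Suc m" using assms by (cases v) auto
  have "(\<lambda>i. {(v @ [x]) ! i, (v @ [x]) ! Suc i}) ` {..<m} = (\<lambda>i. {v ! i, v ! Suc i}) ` {..<m}"
    using m by (intro image_cong) (auto simp: nth_append)
  then show ?thesis
    using m assms by (simp add: path_edges_eq_image lessThan_Suc nth_append last_conv_nth)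
qed

lemma finite_path_edges: "finite (path_edges v)"
  by (simp add: path_edges_eq_image)

lemma path_edges_subset: "e \<in> path_edges v \<Longrightarrow> e \<subseteq> set v"
  by (auto simp: path_graph_def)

text \<open>Loop erasure: a step to a vertex that is already listed cuts the list back to that
  vertex, so the list stays distinct.\<close>

lemma rtrancl_imp_simple_path:
  assumes "(a, b) \<in> {(x, y). {x, y} \<in> E}\<^sup>*"
  shows "\<exists>ws. ws \<noteq> [] \<and> hd ws = a \<and> last ws = b \<and> distinct ws \<and>
    (\<forall>i. Suc i < length ws \<longrightarrow> {ws ! i, ws ! Suc i} \<in> E)"
  using assms
proof (induction rule: rtrancl_induct)
  case base
  show ?case by (rule exI[of _ "[a]"]) auto
next
  case (step y z)
  then obtain ws where ws: "ws \<noteq> []" "hd ws = a" "last ws = y" "distinct ws"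
    "\<forall>i. Suc i < length ws \<longrightarrow> {ws ! i, ws ! Suc i} \<in> E" by blast
  show ?case
  proof (cases "z \<in> set ws")
    case True
    then obtain us vs where uv: "ws = us @ z # vs" by (meson split_list)
    have "{(us @ [z]) ! i, (us @ [z]) ! Suc i} \<in> E" if "Suc i < length (us @ [z])" for i
    proof -
      have "{ws ! i, ws ! Suc i} \<in> E" using ws(5) that uv by simp
      moreover have "ws ! i = (us @ [z]) ! i" "ws ! Suc i = (us @ [z]) ! Suc i"
        using that uv by (auto simp: nth_append)
      ultimately show ?thesis by simp
    qed
    moreover have "hd (us @ [z]) = a" using ws(2) uv by (cases us) auto
    moreover have "distinct (us @ [z])" using ws(4) uv by auto
    ultimately show ?thesis by (intro exI[of _ "us @ [z]"]) auto
  next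
    case False
    have "{(ws @ [z]) ! i, (ws @ [z]) ! Suc i} \<in> E" if "Suc i < length (ws @ [z])" for i
    proof (cases "Suc i < length ws")
      case True
      then show ?thesis using ws(5) by (simp add: nth_append)
    next
      case False
      with that have "i = length ws - 1" "Suc i = length ws" by auto
      then show ?thesis using step.hyps(2) ws(1,3) by (simp add: nth_append last_conv_nth)
    qed
    then show ?thesis using ws False by (intro exI[of _ "ws @ [z]"]) auto
  qed
qed

text \<open>A simple path from \<open>a\<close> to \<open>b\<close> that avoids the edge is closed
  up by the edge itself. It has at least three vertices, because with two it would consist of the
  forbidden edge.\<close>

lemma graph_cycle_if_edge_bypassed:
  assumes "{a, b} \<in> E" "a \<noteq> b" "(a, b) \<in> {(x, y). {x, y} \<in> E - {{a, b}}}\<^sup>*"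
  shows "\<exists>ws. graph_cycle (V, E) ws"
proof -
  obtain ws where ws: "ws \<noteq> []" "hd ws = a" "last ws = b" "distinct ws"
    "\<forall>i. Suc i < length ws \<longrightarrow> {ws ! i, ws ! Suc i} \<in> E - {{a, b}}"
    using rtrancl_imp_simple_path[OF assms(3)] by blast
  have "length ws \<noteq> 1" using ws(2,3) assms(2) by (auto simp: length_Suc_conv)
  moreover have "length ws \<noteq> 2"
  proof
    assume l: "length ws = 2"
    then have "{ws ! 0, ws ! 1} \<in> E - {{a, b}}" using ws(5) by force
    moreover have "ws ! 0 = a" "ws ! 1 = b" using ws l by (auto simp: hd_conv_nth last_conv_nth)
    ultimately show False by simp
  qed
  moreover have "length ws \<noteq> 0" using ws(1) by simp
  ultimately have "length ws \<ge> 3" by linarith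
  then have "graph_cycle (V, E) ws"
    using ws assms(1) by (auto simp: graph_cycle_def insert_commute)
  then show ?thesis by blast
qed

text \<open>Indices modulo the length put the closing edge on the same footing as the others, so
  every vertex of a cycle has a successor and a predecessor in uniform notation.\<close>

lemma graph_cycle_cyclic:
  "graph_cycle G ws \<longleftrightarrow> length ws \<ge> 3 \<and> distinct ws \<and>
     (\<forall>i<length ws. {ws ! i, ws ! (Suc i mod length ws)} \<in> snd G)"
proof (cases "length ws \<ge> 3")
  case True
  then have ne: "ws \<noteq> []" by auto
  have split: "(\<forall>i<length ws. Q i) \<longleftrightarrow> (\<forall>i. Suc i < length ws \<longrightarrow> Q i) \<and> Q (length ws - 1)" for Q
  proof -
    have "i < length ws \<longleftrightarrow> Suc i < length ws \<or> i = length ws - 1" for i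
      using True by linarith
    then show ?thesis by blast
  qed
  have l: "ws ! (length ws - 1) = last ws" "ws ! 0 = hd ws" "Suc (length ws - 1) = length ws"
    using ne by (auto simp: last_conv_nth hd_conv_nth)
  show ?thesis unfolding graph_cycle_def split using True l by simp
qed (auto simp: graph_cycle_def)

text \<open>A cycle through the leaf \<open>x\<close> would use two edges at \<open>x\<close>. Both
  must be \<open>{a, x}\<close>, so the cyclic neighbours \<open>l\<close> and \<open>j\<close> of
  the position of \<open>x\<close> both carry \<open>a\<close>. Distinctness gives
  \<open>l = j\<close>, which is impossible in a cycle of length at least 3.\<close>

lemma graph_cycle_remove_leaf:
  assumes cyc: "graph_cycle (V, insert {a, x} E) ws" and x: "x \<notin> \<Union>E" and ax: "a \<noteq> x"
  shows "graph_cycle (W, E) ws"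
proof -
  define L where "L = length ws"
  have L: "L \<ge> 3" "distinct ws" and
    e: "\<And>i. i < L \<Longrightarrow> {ws ! i, ws ! (Suc i mod L)} \<in> insert {a, x} E"
    using cyc by (auto simp: graph_cycle_cyclic L_def)
  have inj: "ws ! i = ws ! j \<longleftrightarrow> i = j" if "i < L" "j < L" for i j
    using L(2) that by (simp add: L_def nth_eq_iff_index_eq)
  have x_notin: "ws ! i \<noteq> x" if i: "i < L" for i
  proof
    assume xi: "ws ! i = x"
    define j where "j = (if i = 0 then L - 1 else i - 1)"
    define l where "l = Suc i mod L"
    have j: "j < L" using i by (simp add: j_def less_imp_diff_less)
    have jL: "Suc j mod L = i" and l: "l < L" using L(1) i by (simp_all add: j_def l_def)
    have "{ws ! i, ws ! l} = {a, x}" "{ws ! j, ws ! i} = {a, x}"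
      using e[OF i] e[OF j] xi x unfolding jL l_def by blast+
    then have "ws ! l = a" "ws ! j = a" using xi ax unfolding doubleton_eq_iff by metis+
    then have "l = j" using inj l j by metis
    moreover have "l \<noteq> j"
      unfolding l_def j_def using i L(1) by (cases "Suc i = L") auto
    ultimately show False by simp
  qed
  have "{ws ! i, ws ! (Suc i mod L)} \<in> E" if i: "i < L" for i
  proof -
    have "Suc i mod L < L" using L by simp
    then show ?thesis using e[OF i] x_notin[OF i] x_notin by (auto simp: doubleton_eq_iff)
  qed
  then show ?thesis using L by (auto simp: graph_cycle_cyclic L_def)
qed

text \<open>The edge set \<open>F\<close> is arbitrary because the lemma is applied both to all
  edges of a path and to the edges left after deleting one.\<close>

lemma subpath_connected:
  assumes "i \<le> j" "\<And>l. i \<le> l \<Longrightarrow> l < j \<Longrightarrow> {v ! l, v ! Suc l} \<in> F"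
  shows "(v ! i, v ! j) \<in> {(x, y). {x, y} \<in> F}\<^sup>*"
  using assms
proof (induction j rule: dec_induct)
  case (step j)
  then have "(v ! i, v ! j) \<in> {(x, y). {x, y} \<in> F}\<^sup>*" by simp
  moreover have "(v ! j, v ! Suc j) \<in> {(x, y). {x, y} \<in> F}" using step by auto
  ultimately show ?case by (rule rtrancl_into_rtrancl)
qed simp

lemma edge_relation_rtrancl_sym:
  "(a, b) \<in> {(x, y). {x, y} \<in> F}\<^sup>* \<Longrightarrow> (b, a) \<in> {(x, y). {x, y} \<in> F}\<^sup>*"
  by (metis (mono_tags, lifting) CollectD CollectI insert_commute old.prod.case symD symI sym_rtrancl)

lemma path_vertices_connected:
  assumes "a \<in> set v" "b \<in> set v"
  shows "(a, b) \<in> {(x, y). {x, y} \<in> path_edges v}\<^sup>*"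
proof -
  obtain i j where ij: "i < length v" "j < length v" "a = v ! i" "b = v ! j"
    using assms by (metis in_set_conv_nth)
  have *: "(v ! i, v ! j) \<in> {(x, y). {x, y} \<in> path_edges v}\<^sup>*"
    if "i \<le> j" "j < length v" for i j
    using that by (intro subpath_connected) (auto simp: path_graph_def)
  show ?thesis
    using *[of i j] *[of j i] edge_relation_rtrancl_sym ij by (metis linorder_le_cases)
qed

text \<open>Follow the path step by step: a step to a new vertex adds a leaf, and a step along a new edge
  between old vertices closes a cycle, since the part already traversed is connected.\<close>
lemma path_edges_card:
  assumes "v \<noteq> []" "\<And>i. Suc i < length v \<Longrightarrow> v ! i \<noteq> v ! Suc i"
  shows "card (set v) \<le> Suc (card (path_edges v)) \<and>
    (Suc (card (path_edges v)) = card (set v) \<longleftrightarrow> (\<nexists>ws. graph_cycle (path_graph v) ws))"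
  using assms
proof (induction v rule: rev_nonempty_induct)
  case (single x)
  have E: "path_edges [x] = {}" by (simp add: path_edges_eq_image)
  have "\<not> graph_cycle (path_graph [x]) ws" for ws
    unfolding graph_cycle_def E by blast
  then show ?case unfolding E by simp
next
  case (snoc x v)
  have consec: "v ! i \<noteq> v ! Suc i" if "Suc i < length v" for i
    using snoc.prems[of i] that by (simp add: nth_append)
  \<comment> \<open>Acyclicity becomes a property of the edge set alone, so that the graphs before
    and after the new step can be compared although their vertex sets may differ.\<close>
  define C where "C E \<longleftrightarrow> (\<exists>ws. graph_cycle (UNIV, E) ws)" for E :: "'a set set"
  have C: "(\<exists>ws. graph_cycle G ws) \<longleftrightarrow> C (snd G)" for G
    by (simp add: C_def graph_cycle_def)
  have IH: "card (set v) \<le> Suc (card (path_edges v))"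
    "Suc (card (path_edges v)) = card (set v) \<longleftrightarrow> \<not> C (path_edges v)"
    using snoc.IH[OF consec] unfolding C by simp_all
  have x: "last v \<noteq> x"
    using snoc.prems[of "length v - 1"] snoc.hyps by (simp add: nth_append last_conv_nth)
  have E: "path_edges (v @ [x]) = insert {last v, x} (path_edges v)"
    by (rule path_edges_snoc[OF snoc.hyps])
  consider (new) "x \<notin> set v" | (old) "x \<in> set v" "{last v, x} \<in> path_edges v"
    | (chord) "x \<in> set v" "{last v, x} \<notin> path_edges v" by blast
  then show ?case
  proof cases
    case new
    then have e: "{last v, x} \<notin> path_edges v" and xE: "x \<notin> \<Union>(path_edges v)"
      using path_edges_subset[of _ v] by blast+
    have "graph_cycle (UNIV, path_edges v) ws" if "graph_cycle (UNIV, path_edges (v @ [x])) ws" for ws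
      using graph_cycle_remove_leaf[OF that[unfolded E] xE x] .
    moreover have "graph_cycle (UNIV, path_edges (v @ [x])) ws"
      if "graph_cycle (UNIV, path_edges v) ws" for ws
      using that unfolding E by (simp add: graph_cycle_def)
    ultimately have "C (path_edges (v @ [x])) \<longleftrightarrow> C (path_edges v)"
      unfolding C_def by blast
    moreover have "card (path_edges (v @ [x])) = Suc (card (path_edges v))"
      using e by (simp add: E finite_path_edges)
    ultimately show ?thesis using IH new unfolding C by auto
  next
    case old
    then show ?thesis
      using IH unfolding C E by (simp add: insert_absorb)
  next
    case chord
    have "(last v, x) \<in> {(a, b). {a, b} \<in> path_edges v}\<^sup>*"
      using chord(1) snoc.hyps by (intro path_vertices_connected) auto
    moreover have del: "insert {last v, x} (path_edges v) - {{last v, x}} = path_edges v"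
      using chord(2) by simp
    ultimately have "C (path_edges (v @ [x]))"
      unfolding C_def E using x by (intro graph_cycle_if_edge_bypassed[of "last v" x]) (simp_all only: del, simp_all)
    moreover have "card (path_edges (v @ [x])) = Suc (card (path_edges v))"
      using chord(2) by (simp add: E finite_path_edges)
    ultimately show ?thesis
      using IH(1) chord(1) unfolding C by (simp add: insert_absorb)
  qed
qed

text \<open>A path graph is connected, so being a tree is being acyclic, which is an edge count. In
  this form the condition can be compared with the exponent of \<open>p / n\<close>.\<close>

lemma is_tree_path_graph_iff:
  assumes "is_path I k v"
  shows "is_tree (path_graph v) \<longleftrightarrow> Suc (card (path_edges v)) = card (set v)"
proof -
  have v: "v \<noteq> []" "\<And>i. Suc i < length v \<Longrightarrow> v ! i \<noteq> v ! Suc i"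
    using assms by (auto simp: is_path_def)
  have "graph_connected (path_graph v)"
    using v(1) path_vertices_connected[of _ v] by (auto simp: graph_connected_def path_graph_def)
  then show ?thesis using path_edges_card[OF v] by (simp add: is_tree_def)
qed

lemma card_path_edges_ge:
  assumes "is_path I k v"
  shows "card (set v) \<le> Suc (card (path_edges v))"
  using assms by (intro conjunct1[OF path_edges_card]) (auto simp: is_path_def)

text \<open>If step \<open>i\<close> were the only use of its edge, the rest of the closed path
  would lead from the end of the step round to its start without that edge, and the edge would lie
  on a cycle.\<close>

lemma closed_tree_path_edge_repeated:
  assumes v: "is_path I k v" "v ! k = v ! 0" and tree: "is_tree (path_graph v)"
    and i: "i < k"
  shows "\<exists>j<k. j \<noteq> i \<and> {v ! j, v ! Suc j} = {v ! i, v ! Suc i}"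
proof (rule ccontr)
  assume neg: "\<not> ?thesis"
  define e where "e = {v ! i, v ! Suc i}"
  have len: "length v = Suc k" using v by (simp add: is_path_def)
  have F: "{v ! l, v ! Suc l} \<in> path_edges v - {e}" if "l < k" "l \<noteq> i" for l
    using neg that len by (auto simp: path_graph_def e_def)
  have "(v ! 0, v ! i) \<in> {(x, y). {x, y} \<in> path_edges v - {e}}\<^sup>*"
    using i F by (intro subpath_connected) auto
  moreover have "(v ! Suc i, v ! k) \<in> {(x, y). {x, y} \<in> path_edges v - {e}}\<^sup>*"
    using i F by (intro subpath_connected) auto
  ultimately have "(v ! Suc i, v ! i) \<in> {(x, y). {x, y} \<in> path_edges v - {e}}\<^sup>*"
    using v(2) by simp
  then have "(v ! i, v ! Suc i) \<in> {(x, y). {x, y} \<in> path_edges v - {e}}\<^sup>*"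
    by (rule edge_relation_rtrancl_sym)
  moreover have "e \<in> path_edges v" using i len by (auto simp: path_graph_def e_def)
  moreover have "v ! i \<noteq> v ! Suc i" using v i by (auto simp: is_path_def)
  ultimately have "\<exists>ws. graph_cycle (set v, path_edges v) ws"
    unfolding e_def by (intro graph_cycle_if_edge_bypassed)
  then show False using tree by (simp add: is_tree_def path_graph_def)
qed

text \<open>Group the \<open>k\<close> steps by the edge they traverse: every group has at least two
  members.\<close>

lemma closed_tree_path_card_edges:
  assumes v: "is_path I k v" "v ! k = v ! 0" and tree: "is_tree (path_graph v)"
  shows "2 * card (path_edges v) \<le> k"
proof -
  define g where "g i = {v ! i, v ! Suc i}" for i
  have len: "length v = Suc k" using v by (simp add: is_path_def)
  have E: "path_edges v = g ` {..<k}" by (simp add: path_edges_eq_image len g_def)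
  have "2 \<le> card {i \<in> {..<k}. g i = e}" if e: "e \<in> path_edges v" for e
  proof -
    obtain i where i: "i < k" "g i = e" using e E by auto
    obtain j where j: "j < k" "j \<noteq> i" "g j = e"
      using closed_tree_path_edge_repeated[OF v tree i(1)] i by (auto simp: g_def)
    have "card {i, j} \<le> card {i \<in> {..<k}. g i = e}"
      using i j by (intro card_mono) auto
    then show ?thesis using j by simp
  qed
  then have "(\<Sum>e\<in>path_edges v. 2) \<le> (\<Sum>e\<in>path_edges v. card {i \<in> {..<k}. g i = e})"
    by (intro sum_mono)
  also have "\<dots> = (\<Sum>e\<in>path_edges v. \<Sum>i\<in>{i \<in> {..<k}. g i = e}. 1)" by simp
  also have "\<dots> = (\<Sum>i<k. 1)" by (rule sum.group) (auto simp: E)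
  finally show ?thesis by simp
qed

section \<open>Relabelling canonical paths\<close>

text \<open>Once the labels used are \<open>{1..s}\<close>, the running maximum is \<open>s\<close>,
  and canonicity restricts the next label only by \<open>a \<le> s + 1\<close>.\<close>

lemma canonical_snoc:
  assumes "canonical i" "i \<noteq> []" "set i = {1..s}" "a \<le> s + 1"
  shows "canonical (i @ [a])"
  unfolding canonical_def
proof (intro conjI allI impI)
  show "(i @ [a]) ! 0 = 1" using assms by (simp add: canonical_def nth_append)
  fix j assume j: "1 \<le> j \<and> j < length (i @ [a])"
  have eq: "{(i @ [a]) ! l | l. l < j} = {i ! l | l. l < j}"
  proof -
    have "(i @ [a]) ! l = i ! l" if "l < j" for l using j that by (simp add: nth_append)
    then show ?thesis by force
  qed
  show "(i @ [a]) ! j \<le> Max {(i @ [a]) ! l | l. l < j} + 1"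
  proof (cases "j < length i")
    case True
    then show ?thesis unfolding eq using assms(1) j by (simp add: canonical_def nth_append)
  next
    case False
    then have j: "j = length i" using j by simp
    have "{i ! l | l. l < j} = {1..s}" using assms(3) j by (auto simp: set_conv_nth)
    moreover have "s \<ge> 1" using assms(2,3) by (cases "s = 0") auto
    ultimately have "Max {i ! l | l. l < j} = s" by (auto intro!: Max_eqI)
    then show ?thesis unfolding eq using assms(4) j by simp
  qed
qed

text \<open>A distinct \<open>xs\<close> encodes an injection of the labels
  \<open>1, ..., length xs\<close>; labels count from 1 and list positions from 0, hence the
  shift.\<close>

definition relabel :: "'a list \<Rightarrow> nat list \<Rightarrow> 'a list" where
  "relabel xs i = map (\<lambda>a. xs ! (a - 1)) i"

lemma relabel_inj_on:
  assumes "distinct xs"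
  shows "inj_on (\<lambda>a. xs ! (a - 1)) {1..length xs}"
  using assms by (auto simp: inj_on_def nth_eq_iff_index_eq)

text \<open>The list \<open>xs\<close> built here records the vertices in order of first appearance,
  and \<open>i\<close> replaces each vertex by its rank in \<open>xs\<close>.\<close>

lemma canonical_relabel_exists:
  assumes "v \<noteq> []"
  shows "\<exists>i xs. distinct xs \<and> set xs = set v \<and> canonical i \<and> set i = {1..length xs} \<and> relabel xs i = v"
  using assms
proof (induction v rule: rev_nonempty_induct)
  case (single x)
  show ?case by (intro exI[of _ "[1]"] exI[of _ "[x]"]) (auto simp: canonical_def relabel_def)
next
  case (snoc x v)
  then obtain i xs where ix: "distinct xs" "set xs = set v" "canonical i"
    "set i = {1..length xs}" "relabel xs i = v" by blast
  have i: "i \<noteq> []" using ix(5) snoc.hyps by (auto simp: relabel_def)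
  show ?case
  proof (cases "x \<in> set v")
    case True
    then obtain b where b: "b < length xs" "xs ! b = x" using ix(2) by (metis in_set_conv_nth)
    have "canonical (i @ [Suc b])" using ix i b by (intro canonical_snoc) auto
    then show ?thesis
      using ix b True by (intro exI[of _ "i @ [Suc b]"] exI[of _ xs]) (auto simp: relabel_def)
  next
    case False
    have "canonical (i @ [Suc (length xs)])" using ix i by (intro canonical_snoc) auto
    moreover have "relabel (xs @ [x]) i = relabel xs i"
      using ix(4) by (auto simp: relabel_def nth_append)
    ultimately show ?thesis
      using ix False
      by (intro exI[of _ "i @ [Suc (length xs)]"] exI[of _ "xs @ [x]"])
        (auto simp: relabel_def nth_append)
  qed
qed

lemma canonical_new_vertex:
  assumes v: "canonical v" "set v \<subseteq> {1..n}" and j: "1 \<le> j" "j < length v"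
    and new: "v ! j \<notin> {v ! i | i. i < j}"
  shows "v ! j = Suc (card {v ! i | i. i < j})"
proof -
  define S where "S = {v ! i | i. i < j}"
  have S: "S = {1..card S}" unfolding S_def using canonical_prefix[OF v j(1)] j by simp
  have "v ! 0 \<in> S" using j by (auto simp: S_def)
  then have "card S \<ge> 1" using S by (cases "card S = 0") auto
  then have "Max {1..card S} = card S" by (intro Max_eqI) auto
  then have "Max S = card S" using S by simp
  then have "v ! j \<le> card S + 1" using v(1) j by (auto simp: canonical_def S_def)
  moreover have "v ! j \<ge> 1" using v(2) j nth_mem[of j v] by fastforce
  moreover have "v ! j \<notin> {1..card S}" using new S by (simp add: S_def)
  ultimately show ?thesis unfolding S_def by auto
qed

lemma canonical_unique:
  assumes v: "canonical v" "set v \<subseteq> {1..n}" and w: "canonical w" "set w \<subseteq> {1..m}"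
    and len: "length v = length w"
    and pat: "\<And>i j. i < length v \<Longrightarrow> j < length v \<Longrightarrow> v ! i = v ! j \<longleftrightarrow> w ! i = w ! j"
  shows "v = w"
proof (rule nth_equalityI[OF len])
  fix j assume "j < length v"
  then show "v ! j = w ! j"
  proof (induction j rule: less_induct)
    case (less j)
    have IH: "v ! l = w ! l" if "l < j" for l using less that by simp
    show ?case
    proof (cases "j = 0")
      case True
      then show ?thesis using v(1) w(1) by (simp add: canonical_def)
    next
      case False
      have eq: "{v ! i | i. i < j} = {w ! i | i. i < j}" using IH by force
      show ?thesis
      proof (cases "v ! j \<in> {v ! i | i. i < j}")
        case True
        then obtain i where i: "i < j" "v ! j = v ! i" by auto
        then have "w ! j = w ! i" using pat[of j i] less.prems by simp
        then show ?thesis using i IH by simp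
      next
        case new: False
        have "w ! j \<notin> {w ! i | i. i < j}"
        proof
          assume "w ! j \<in> {w ! i | i. i < j}"
          then obtain i where i: "i < j" "w ! j = w ! i" by auto
          then have "v ! j = v ! i" using pat[of j i] less.prems by simp
          with i(1) new show False by blast
        qed
        then have "w ! j = Suc (card {w ! i | i. i < j})"
          using False less.prems len by (intro canonical_new_vertex[OF w]) auto
        moreover have "v ! j = Suc (card {v ! i | i. i < j})"
          using False less.prems new by (intro canonical_new_vertex[OF v]) auto
        ultimately show ?thesis by (simp only: eq)
      qed
    qed
  qed
qed

text \<open>All shapes with \<open>t\<close> vertices, trees or not: at finite \<open>n\<close> the
  other shapes still contribute to the trace.\<close>

definition canonical_closed_paths :: "nat \<Rightarrow> nat \<Rightarrow> nat list set" where
  "canonical_closed_paths k t = {i \<in> closed_paths k t. canonical i \<and> set i = {1..t}}"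

lemma finite_closed_paths: "finite (closed_paths k n)"
  by (rule finite_subset[OF _ finite_lists_length_eq[of "{1..n}" "Suc k"]])
    (auto simp: closed_paths_def is_path_def)

lemma finite_canonical_closed_paths: "finite (canonical_closed_paths k t)"
  by (simp add: canonical_closed_paths_def finite_closed_paths)

text \<open>A closed path is a shape together with an injective labelling. The shape is recovered
  from the coincidences, and the labelling because the shape uses every label. A path with
  \<open>k + 1\<close> entries has at most \<open>k + 1\<close> vertices, so the range of
  \<open>t\<close> is independent of \<open>n\<close>.\<close>

lemma bij_betw_relabel:
  "bij_betw (\<lambda>(t, i, xs). relabel xs i)
     (SIGMA t:{..Suc k}. canonical_closed_paths k t \<times>
        {xs. length xs = t \<and> distinct xs \<and> set xs \<subseteq> {1..n}})
     (closed_paths k n)"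
  unfolding bij_betw_def
proof (intro conjI inj_onI equalityI subsetI)
  let ?S = "SIGMA t:{..Suc k}. canonical_closed_paths k t \<times>
        {xs. length xs = t \<and> distinct xs \<and> set xs \<subseteq> {1..n}}"
  fix y z assume y: "y \<in> ?S" and z: "z \<in> ?S"
    and eq0: "(\<lambda>(t, i, xs). relabel xs i) y = (\<lambda>(t, i, xs). relabel xs i) z"
  obtain t i xs where yt: "y = (t, i, xs)" by (cases y)
  obtain t' i' xs' where zt: "z = (t', i', xs')" by (cases z)
  have i: "canonical i" "set i = {1..t}" "length xs = t" "distinct xs"
    using y yt by (auto simp: canonical_closed_paths_def)
  have i': "canonical i'" "set i' = {1..t'}" "length xs' = t'" "distinct xs'"
    using z zt by (auto simp: canonical_closed_paths_def)
  have eq: "relabel xs i = relabel xs' i'" using eq0 yt zt by simp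
  have len: "length i = length i'" using arg_cong[OF eq, of length] by (simp add: relabel_def)
  have nth: "xs ! (i ! j - 1) = xs' ! (i' ! j - 1)" if "j < length i" for j
    using arg_cong[OF eq, of "\<lambda>v. v ! j"] that len by (simp add: relabel_def)
  have "i ! j = i ! l \<longleftrightarrow> i' ! j = i' ! l" if "j < length i" "l < length i" for j l
  proof -
    have "i ! j = i ! l \<longleftrightarrow> xs ! (i ! j - 1) = xs ! (i ! l - 1)"
      using inj_on_eq_iff[OF relabel_inj_on[OF i(4)]] i(2,3) that nth_mem[of _ i] by metis
    also have "\<dots> \<longleftrightarrow> xs' ! (i' ! j - 1) = xs' ! (i' ! l - 1)" using nth that by simp
    also have "\<dots> \<longleftrightarrow> i' ! j = i' ! l"
      using inj_on_eq_iff[OF relabel_inj_on[OF i'(4)]] i'(2,3) that nth_mem[of _ i'] len by metis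
    finally show ?thesis .
  qed
  then have ii: "i = i'" using i i' len by (intro canonical_unique[of i t i' t']) auto
  then have tt: "t = t'" using i(2) i'(2) by (metis card_atLeastAtMost diff_Suc_1)
  have "xs = xs'"
  proof (rule nth_equalityI)
    show "length xs = length xs'" using i(3) i'(3) tt by simp
    fix b assume "b < length xs"
    then have "Suc b \<in> set i" using i by simp
    then obtain j where "j < length i" "i ! j = Suc b" by (metis in_set_conv_nth)
    then show "xs ! b = xs' ! b" using nth[of j] ii by simp
  qed
  then show "y = z" using ii tt yt zt by simp
next
  let ?S = "SIGMA t:{..Suc k}. canonical_closed_paths k t \<times>
        {xs. length xs = t \<and> distinct xs \<and> set xs \<subseteq> {1..n}}"
  fix v assume "v \<in> (\<lambda>(t, i, xs). relabel xs i) ` ?S"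
  then obtain t i xs where v: "v = relabel xs i" "i \<in> canonical_closed_paths k t"
    "length xs = t" "distinct xs" "set xs \<subseteq> {1..n}" by auto
  have i: "k \<ge> 1" "length i = Suc k" "set i = {1..t}" "\<And>j. j < k \<Longrightarrow> i ! j \<noteq> i ! Suc j" "i ! k = i ! 0"
    using v(2) by (auto simp: canonical_closed_paths_def closed_paths_def is_path_def)
  have "set v \<subseteq> set xs" using i(3) v(1,3) by (auto simp: relabel_def intro!: nth_mem)
  moreover have "v ! j \<noteq> v ! Suc j" if j: "j < k" for j
  proof -
    have "i ! j \<in> {1..length xs}" "i ! Suc j \<in> {1..length xs}"
      using i(2,3) j v(3) nth_mem[of j i] nth_mem[of "Suc j" i] by auto
    then show ?thesis
      using inj_on_eq_iff[OF relabel_inj_on[OF v(4)]] i(2) i(4)[OF j] j v(1)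
      by (simp add: relabel_def)
  qed
  ultimately show "v \<in> closed_paths k n"
    using v i by (auto simp: closed_paths_def is_path_def relabel_def)
next
  let ?S = "SIGMA t:{..Suc k}. canonical_closed_paths k t \<times>
        {xs. length xs = t \<and> distinct xs \<and> set xs \<subseteq> {1..n}}"
  fix v assume "v \<in> closed_paths k n"
  then have v: "k \<ge> 1" "length v = Suc k" "set v \<subseteq> {1..n}" "\<And>j. j < k \<Longrightarrow> v ! j \<noteq> v ! Suc j"
    "v ! k = v ! 0"
    by (auto simp: closed_paths_def is_path_def)
  then have "v \<noteq> []" by auto
  then obtain i xs where ix: "distinct xs" "set xs = set v" "canonical i" "set i = {1..length xs}"
    "relabel xs i = v" using canonical_relabel_exists by blast
  have leni: "length i = Suc k" using ix(5) v(2) by (auto simp: relabel_def)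
  have nth: "v ! j = xs ! (i ! j - 1)" if "j \<le> k" for j
    using that leni by (simp add: relabel_def flip: ix(5))
  have "length xs = card (set v)" using distinct_card[OF ix(1)] ix(2) by simp
  also have "\<dots> \<le> Suc k" using card_length[of v] v(2) by simp
  finally have "length xs \<le> Suc k" .
  moreover have "i ! j \<noteq> i ! Suc j" if "j < k" for j
    using v(4)[OF that] nth[of j] nth[of "Suc j"] that by auto
  moreover have "i ! k = i ! 0"
  proof -
    have "i ! k \<in> {1..length xs}" "i ! 0 \<in> {1..length xs}"
      using ix(4) leni nth_mem[of k i] nth_mem[of 0 i] by auto
    then show ?thesis
      using inj_on_eq_iff[OF relabel_inj_on[OF ix(1)]] v(5) nth[of k] nth[of 0] by simp
  qed
  ultimately have "(length xs, i, xs) \<in> ?S"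
    using ix v leni by (auto simp: canonical_closed_paths_def closed_paths_def is_path_def)
  then show "v \<in> (\<lambda>(t, i, xs). relabel xs i) ` ?S"
    using ix(5) by (intro image_eqI[of _ _ "(length xs, i, xs)"]) auto
qed

text \<open>Since \<open>Gamma_paths\<close> takes \<open>n = t\<close>, having \<open>t\<close>
  distinct vertices forces the vertex set to be all of \<open>{1..t}\<close>.\<close>

lemma Gamma_paths_eq:
  "Gamma_paths k t = {i \<in> canonical_closed_paths k t. Suc (card (path_edges i)) = t}"
proof (rule Set.set_eqI)
  fix v :: "nat list"
  have fst: "fst (path_graph v) = set v" by (simp add: path_graph_def)
  show "v \<in> Gamma_paths k t \<longleftrightarrow> v \<in> {i \<in> canonical_closed_paths k t. Suc (card (path_edges i)) = t}"
  proof (cases "v \<in> closed_paths k t")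
    case True
    then have p: "is_path {1..t} k v" and sub: "set v \<subseteq> {1..t}"
      by (auto simp: closed_paths_def is_path_def)
    have "card (set v) = t \<longleftrightarrow> set v = {1..t}"
      using card_subset_eq[OF _ sub] by auto
    then show ?thesis
      using True is_tree_path_graph_iff[OF p]
      by (auto simp: Gamma_paths_def canonical_tree_paths_def canonical_closed_paths_def fst)
  qed (simp add: Gamma_paths_def canonical_tree_paths_def canonical_closed_paths_def)
qed

section \<open>Expectations over independent coordinates\<close>

lemma finite_set_Pi_pmf:
  fixes p :: "'a \<Rightarrow> 'b :: finite pmf"
  assumes "finite A"
  shows "finite (set_pmf (Pi_pmf A dflt p))"
  using set_Pi_pmf_subset'[OF assms] by (rule finite_subset) (auto intro: finite_PiE_dflt assms)

lemma expectation_pair_pmf_mult: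
  fixes f :: "'a \<Rightarrow> real" and g :: "'b \<Rightarrow> real"
  assumes "finite (set_pmf p)" "finite (set_pmf q)"
  shows "measure_pmf.expectation (pair_pmf p q) (\<lambda>(x, y). f x * g y) =
    measure_pmf.expectation p f * measure_pmf.expectation q g"
proof -
  have "measure_pmf.expectation (pair_pmf p q) (\<lambda>(x, y). f x * g y) =
      (\<Sum>(x, y)\<in>set_pmf p \<times> set_pmf q. (f x * pmf p x) * (g y * pmf q y))"
    using assms by (subst integral_measure_pmf[of "set_pmf p \<times> set_pmf q"])
      (auto simp: pmf_pair mult_ac intro!: sum.cong)
  also have "\<dots> = (\<Sum>x\<in>set_pmf p. f x * pmf p x) * (\<Sum>y\<in>set_pmf q. g y * pmf q y)"
    by (simp add: sum_product sum.cartesian_product)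
  also have "\<dots> = measure_pmf.expectation p f * measure_pmf.expectation q g"
    using assms by (simp add: integral_measure_pmf[of "set_pmf p"]
        integral_measure_pmf[of "set_pmf q"] mult.commute)
  finally show ?thesis .
qed

text \<open>Independence of functions that read disjoint coordinates: the product law is split at
  \<open>A\<close>. Finite coordinate types make the supports finite, so all expectations are finite
  sums.\<close>

lemma expectation_Pi_pmf_mult:
  fixes p :: "'a \<Rightarrow> 'b :: finite pmf" and h1 h2 :: "('a \<Rightarrow> 'b) \<Rightarrow> real"
  assumes P: "finite P" and A: "A \<subseteq> P"
    and h1: "\<And>f g. (\<And>x. x \<in> A \<Longrightarrow> f x = g x) \<Longrightarrow> h1 f = h1 g"
    and h2: "\<And>f g. (\<And>x. x \<in> P - A \<Longrightarrow> f x = g x) \<Longrightarrow> h2 f = h2 g"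
  shows "measure_pmf.expectation (Pi_pmf P dflt p) (\<lambda>f. h1 f * h2 f) =
    measure_pmf.expectation (Pi_pmf P dflt p) h1 * measure_pmf.expectation (Pi_pmf P dflt p) h2"
proof -
  let ?PA = "Pi_pmf A dflt p" and ?PB = "Pi_pmf (P - A) dflt p"
  have fin: "finite A" "finite (P - A)" using P A by (auto intro: finite_subset)
  have "P = A \<union> (P - A)" using A by blast
  then have Pi: "Pi_pmf P dflt p =
      map_pmf (\<lambda>(f, g) x. if x \<in> A then f x else g x) (pair_pmf ?PA ?PB)"
    using Pi_pmf_union[OF fin, of dflt p] by auto
  have m1: "h1 (\<lambda>x. if x \<in> A then f x else g x) = h1 f" for f g by (rule h1) simp
  have m2: "h2 (\<lambda>x. if x \<in> A then f x else g x) = h2 g" for f g by (rule h2) simp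
  note fs = finite_set_Pi_pmf[OF fin(1), of dflt p] finite_set_Pi_pmf[OF fin(2), of dflt p]
  have "measure_pmf.expectation (Pi_pmf P dflt p) (\<lambda>f. h1 f * h2 f) =
      measure_pmf.expectation ?PA h1 * measure_pmf.expectation ?PB h2"
    unfolding Pi by (simp add: case_prod_unfold m1 m2
        expectation_pair_pmf_mult[OF fs, unfolded case_prod_unfold])
  moreover have "measure_pmf.expectation (Pi_pmf P dflt p) h1 = measure_pmf.expectation ?PA h1"
    unfolding Pi using expectation_pair_pmf_mult[OF fs, of h1 "\<lambda>_. 1"]
    by (simp add: case_prod_unfold m1)
  moreover have "measure_pmf.expectation (Pi_pmf P dflt p) h2 = measure_pmf.expectation ?PB h2"
    unfolding Pi using expectation_pair_pmf_mult[OF fs, of "\<lambda>_. 1" h2]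
    by (simp add: case_prod_unfold m2)
  ultimately show ?thesis by simp
qed

lemma expectation_Pi_bernoulli_pattern:
  assumes P: "finite P" and sub: "E \<subseteq> P" "C \<subseteq> P" "E \<inter> C = {}" and a: "0 \<le> a" "a \<le> 1"
  shows "measure_pmf.expectation (Pi_pmf P dflt (\<lambda>_. bernoulli_pmf a))
      (\<lambda>f. of_bool ((\<forall>e\<in>E. f e) \<and> (\<forall>e\<in>C. \<not> f e))) = a ^ card E * (1 - a) ^ card C"
proof -
  \<comment> \<open>The indicator of the pattern is written as a product over all coordinates, with
    factor 1 at those the pattern leaves free.\<close>
  define h :: "'a \<Rightarrow> bool \<Rightarrow> real" where
    "h e b = (if e \<in> E then of_bool b else if e \<in> C then of_bool (\<not> b) else 1)" for e b
  have split: "(\<Prod>e\<in>P. H e) = (\<Prod>e\<in>E. H e) * (\<Prod>e\<in>C. H e)"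
    if "\<And>e. e \<notin> E \<Longrightarrow> e \<notin> C \<Longrightarrow> H e = 1" for H :: "'a \<Rightarrow> real"
  proof -
    have "(\<Prod>e\<in>P. H e) = (\<Prod>e\<in>E \<union> C. H e)"
      using P sub that by (intro prod.mono_neutral_right) auto
    also have "\<dots> = (\<Prod>e\<in>E. H e) * (\<Prod>e\<in>C. H e)"
      using P sub by (intro prod.union_disjoint) (auto intro: finite_subset)
    finally show ?thesis .
  qed
  have C: "e \<in> C \<Longrightarrow> e \<notin> E" for e using sub by auto
  have pat: "(of_bool ((\<forall>e\<in>E. f e) \<and> (\<forall>e\<in>C. \<not> f e)) :: real) = (\<Prod>e\<in>P. h e (f e))" for f
  proof -
    have "(\<Prod>e\<in>P. h e (f e)) = (\<Prod>e\<in>E. of_bool (f e)) * (\<Prod>e\<in>C. of_bool (\<not> f e))"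
      by (subst split) (auto simp: h_def C intro!: arg_cong2[of _ _ _ _ "(*)"] prod.cong)
    also have "\<dots> = of_bool ((\<forall>e\<in>E. f e) \<and> (\<forall>e\<in>C. \<not> f e))"
      using finite_subset[OF sub(1) P] finite_subset[OF sub(2) P]
      by (cases "\<forall>e\<in>E. f e"; cases "\<forall>e\<in>C. \<not> f e") auto
    finally show ?thesis by simp
  qed
  have "measure_pmf.expectation (Pi_pmf P dflt (\<lambda>_. bernoulli_pmf a)) (\<lambda>f. \<Prod>e\<in>P. h e (f e)) =
      (\<Prod>e\<in>P. measure_pmf.expectation (bernoulli_pmf a) (h e))"
    by (rule expectation_prod_Pi_pmf[OF P])
      (auto simp: h_def intro: integrable_measure_pmf_finite)
  also have "\<dots> = (\<Prod>e\<in>E. a) * (\<Prod>e\<in>C. 1 - a)"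
    using a by (subst split) (auto simp: h_def C intro!: arg_cong2[of _ _ _ _ "(*)"] prod.cong)
  finally show ?thesis by (simp add: pat)
qed

lemma expectation_Pi_bernoulli_card:
  fixes g :: "nat \<Rightarrow> real"
  assumes P: "finite P" and S: "S \<subseteq> P" and a: "0 \<le> a" "a \<le> 1"
  shows "measure_pmf.expectation (Pi_pmf P dflt (\<lambda>_. bernoulli_pmf a)) (\<lambda>f. g (card {e \<in> S. f e})) =
    measure_pmf.expectation (binomial_pmf (card S) a) g"
proof -
  have fin: "finite S" using P S by (rule finite_subset[rotated])
  have set: "{e \<in> S. if e \<in> S then f e else dflt} = {e \<in> S. f e}" for f by auto
  have "binomial_pmf (card S) a = map_pmf (\<lambda>f. card {e \<in> S. f e}) (Pi_pmf S dflt (\<lambda>_. bernoulli_pmf a))"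
    using fin a by (intro binomial_pmf_altdef') auto
  also have "\<dots> = map_pmf (\<lambda>f. card {e \<in> S. f e}) (Pi_pmf P dflt (\<lambda>_. bernoulli_pmf a))"
    by (simp add: Pi_pmf_subset[OF P S] pmf.map_comp comp_def set)
  finally show ?thesis by simp
qed

section \<open>Poisson limit of binomial expectations\<close>

lemma expectation_nat_pmf_eq_suminf:
  fixes g :: "nat \<Rightarrow> real"
  assumes "\<And>j. \<bar>g j\<bar> \<le> B"
  shows "measure_pmf.expectation q g = (\<Sum>j. pmf q j * g j)"
proof -
  have "integrable (measure_pmf q) g"
    using assms by (intro measure_pmf.integrable_const_bound[of _ B]) auto
  then have int: "integrable (count_space UNIV) (\<lambda>j. pmf q j * g j)"
    unfolding measure_pmf_eq_density by (subst (asm) integrable_density) auto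
  have "measure_pmf.expectation q g = (\<integral>j. pmf q j * g j \<partial>count_space UNIV)"
    unfolding measure_pmf_eq_density by (subst integral_density) auto
  also have "\<dots> = (\<Sum>j. pmf q j * g j)" by (rule integral_count_space_nat[OF int])
  finally show ?thesis .
qed

text \<open>The success probability is \<open>p / n\<close> although there are only
  \<open>n - t\<close> trials. The offset \<open>t\<close> is harmless: each of the \<open>j\<close>
  factors of the binomial coefficient is still asymptotic to \<open>n\<close>, and the failure power
  is an \<open>n\<close>-th power, tending to \<open>exp (- p)\<close>, divided by a fixed power
  that tends to 1.\<close>

lemma pmf_binomial_tendsto_poisson:
  assumes p: "p > 0"
  shows "(\<lambda>n. pmf (binomial_pmf (n - t) (p / real n)) j) \<longlonglongrightarrow> pmf (poisson_pmf p) j"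
proof -
  have lim1: "(\<lambda>n. (\<Prod>l<j. (real n - real t - real l) / real n)) \<longlonglongrightarrow> (\<Prod>l<j. 1)"
  proof (intro tendsto_prod)
    fix l
    show "(\<lambda>n. (real n - real t - real l) / real n) \<longlonglongrightarrow> 1" by real_asymp
  qed
  have lim2: "(\<lambda>n. (1 + (- p) / real n) ^ n / (1 + (- p) / real n) ^ (t + j)) \<longlonglongrightarrow> exp (- p) / 1 ^ (t + j)"
  proof (intro tendsto_divide tendsto_power tendsto_exp_limit_sequentially)
    show "(\<lambda>n. 1 + (- p) / real n) \<longlonglongrightarrow> 1" by real_asymp
  qed auto
  have lim: "(\<lambda>n. (\<Prod>l<j. (real n - real t - real l) / real n) / fact j * p ^ j *
      ((1 + (- p) / real n) ^ n / (1 + (- p) / real n) ^ (t + j)))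
      \<longlonglongrightarrow> (\<Prod>l<j. 1) / fact j * p ^ j * (exp (- p) / 1 ^ (t + j))"
    by (intro tendsto_mult tendsto_divide lim1 lim2 tendsto_const) auto
  have "eventually (\<lambda>n. (\<Prod>l<j. (real n - real t - real l) / real n) / fact j * p ^ j *
      ((1 + (- p) / real n) ^ n / (1 + (- p) / real n) ^ (t + j)) =
      pmf (binomial_pmf (n - t) (p / real n)) j) sequentially"
    using eventually_gt_at_top[of "nat \<lceil>p\<rceil>"] eventually_gt_at_top[of "t + j"]
  proof eventually_elim
    case (elim n)
    then have n: "real n > p" "n > t + j" by linarith+
    then have n0: "real n > 0" using p by linarith
    have a: "0 \<le> p / real n" "p / real n \<le> 1" "1 - p / real n > 0" using n n0 p by auto
    have "pmf (binomial_pmf (n - t) (p / real n)) j =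
        real ((n - t) choose j) * (p / real n) ^ j * (1 - p / real n) ^ (n - t - j)"
      using a n by (subst pmf_binomial) auto
    also have "real ((n - t) choose j) = (\<Prod>l<j. (real n - real t - real l)) / fact j"
      using n by (simp add: binomial_gbinomial gbinomial_prod_rev of_nat_diff atLeast0LessThan)
    also have "(1 - p / real n) ^ (n - t - j) = (1 - p / real n) ^ n / (1 - p / real n) ^ (t + j)"
      using a n power_diff[of "1 - p / real n" "t + j" n] by simp
    finally show ?case by (simp add: prod_dividef power_divide)
  qed
  from Lim_transform_eventually[OF lim this] show ?thesis by (simp add: p)
qed

text \<open>Dominated convergence for series. As a binomial coefficient is at most
  \<open>n ^ j / fact j\<close>, every point mass is at most \<open>p ^ j / fact j\<close> as soon
  as \<open>n > p\<close>. This bound is summable and free of \<open>n\<close>.\<close>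

lemma expectation_binomial_tendsto_poisson:
  fixes g :: "nat \<Rightarrow> real"
  assumes p: "p > 0" and g: "\<And>j. \<bar>g j\<bar> \<le> B"
  shows "(\<lambda>n. measure_pmf.expectation (binomial_pmf (n - t) (p / real n)) g)
    \<longlonglongrightarrow> measure_pmf.expectation (poisson_pmf p) g"
proof -
  have B: "0 \<le> B" using g[of 0] by linarith
  have bound: "norm (pmf (binomial_pmf (n - t) (p / real n)) j * g j) \<le> p ^ j / fact j * B"
    if n: "real n > p" for n j
  proof -
    have n0: "real n > 0" using p n by linarith
    have a: "0 \<le> p / real n" "p / real n \<le> 1" "1 - p / real n > 0" using n n0 p by auto
    have "pmf (binomial_pmf (n - t) (p / real n)) j \<le> p ^ j / fact j"
    proof (cases "j \<le> n - t")
      case True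
      have "fact j * ((n - t) choose j) \<le> (n - t) ^ j"
        by (metis binomial_fact_pow mult.commute)
      also have "\<dots> \<le> n ^ j" by (intro power_mono) auto
      finally have "real (fact j * ((n - t) choose j)) \<le> real (n ^ j)" by (rule of_nat_mono)
      then have ch: "real ((n - t) choose j) \<le> real n ^ j / fact j" by (simp add: field_simps)
      have "pmf (binomial_pmf (n - t) (p / real n)) j =
          real ((n - t) choose j) * (p / real n) ^ j * (1 - p / real n) ^ (n - t - j)"
        using a True by (subst pmf_binomial) auto
      also have "\<dots> \<le> real n ^ j / fact j * (p / real n) ^ j * 1"
        using ch a by (intro mult_mono) (auto intro!: power_le_one mult_right_mono)
      also have "\<dots> = p ^ j / fact j" using n0 by (simp add: power_divide)
      finally show ?thesis .
    next
      case False
      then have "pmf (binomial_pmf (n - t) (p / real n)) j = 0" using a by (subst pmf_binomial) auto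
      then show ?thesis using p by simp
    qed
    then show ?thesis unfolding norm_mult using g[of j] p B
      by (intro mult_mono) auto
  qed
  have "(\<lambda>n. \<Sum>j. pmf (binomial_pmf (n - t) (p / real n)) j * g j) \<longlonglongrightarrow>
      (\<Sum>j. pmf (poisson_pmf p) j * g j)"
  proof (rule tannerys_theorem[THEN conjunct2, THEN conjunct2])
    show "(\<lambda>n. pmf (binomial_pmf (n - t) (p / real n)) j * g j) \<longlonglongrightarrow> pmf (poisson_pmf p) j * g j" for j
      by (intro tendsto_mult pmf_binomial_tendsto_poisson p tendsto_const)
    have "eventually (\<lambda>n. real n > p) sequentially" by real_asymp
    then have "eventually (\<lambda>z. real (snd z) > p) (at_top \<times>\<^sub>F sequentially)"
      by (rule eventually_compose_filterlim[OF _ filterlim_snd])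
    then show "eventually (\<lambda>(j, n). norm (pmf (binomial_pmf (n - t) (p / real n)) j * g j) \<le>
        p ^ j / fact j * B) (at_top \<times>\<^sub>F sequentially)"
      by eventually_elim (use bound in auto)
    have "summable (\<lambda>j. p ^ j / fact j)"
      using summable_exp_generic[of p] by (simp add: divide_inverse_commute)
    then show "summable (\<lambda>j. p ^ j / fact j * B)" by (rule summable_mult2)
  qed simp
  then show ?thesis by (simp add: expectation_nat_pmf_eq_suminf[OF g])
qed

section \<open>Expected weights of closed paths\<close>

definition vertex_pairs :: "nat \<Rightarrow> nat set set" where
  "vertex_pairs n = {e. e \<subseteq> {1..n} \<and> card e = 2}"

text \<open>The random graph as a family of independent Boolean coordinates indexed by vertex pairs,
  the form in which independence of disjoint sets of pairs can be used.\<close>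

definition edge_pmf :: "nat \<Rightarrow> real \<Rightarrow> (nat set \<Rightarrow> bool) pmf" where
  "edge_pmf n a = Pi_pmf (vertex_pairs n) False (\<lambda>_. bernoulli_pmf a)"

definition vertex_degree :: "nat \<Rightarrow> (nat set \<Rightarrow> bool) \<Rightarrow> nat \<Rightarrow> nat" where
  "vertex_degree n f u = card {w \<in> {1..n}. w \<noteq> u \<and> f {u, w}}"

text \<open>The product of the entries of \<open>walk_mat\<close> along the steps of
  \<open>v\<close>, that is, the contribution of one closed path to the trace.\<close>

definition path_weight :: "real \<Rightarrow> nat \<Rightarrow> nat list \<Rightarrow> (nat set \<Rightarrow> bool) \<Rightarrow> real" where
  "path_weight c n v f =
     (\<Prod>j<length v - 1. of_bool (f {v ! j, v ! Suc j}) / (c + real (vertex_degree n f (v ! j))))"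

lemma finite_vertex_pairs: "finite (vertex_pairs n)"
  by (simp add: vertex_pairs_def)

lemma finite_set_edge_pmf: "finite (set_pmf (edge_pmf n a))"
  unfolding edge_pmf_def by (intro finite_set_Pi_pmf finite_vertex_pairs)

lemma integrable_edge_pmf: "integrable (edge_pmf n a) (h :: _ \<Rightarrow> real)"
  by (intro integrable_measure_pmf_finite finite_set_edge_pmf)

lemma doubleton_in_vertex_pairs:
  "{u, w} \<in> vertex_pairs n \<longleftrightarrow> u \<in> {1..n} \<and> w \<in> {1..n} \<and> u \<noteq> w"
  by (auto simp: vertex_pairs_def card_2_iff doubleton_eq_iff)

lemma erdos_renyi_eq:
  "erdos_renyi n a = map_pmf (\<lambda>f. ({1..n}, {e \<in> vertex_pairs n. f e})) (edge_pmf n a)"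
  by (simp add: erdos_renyi_def edge_pmf_def vertex_pairs_def Let_def)

lemma nth_mem_subset: "set v \<subseteq> A \<Longrightarrow> l < length v \<Longrightarrow> v ! l \<in> A"
  using nth_mem by blast

section \<open>Traces of matrix powers as sums over closed paths\<close>

lemma pow_mat_entry_eq_sum_paths:
  fixes M :: "'a :: comm_semiring_1 mat"
  assumes M: "M \<in> carrier_mat n n" and ij: "i < n" "j < n"
  shows "(M ^\<^sub>m k) $$ (i, j) =
    (\<Sum>v | length v = Suc k \<and> set v \<subseteq> {1..n} \<and> v ! 0 = Suc i \<and> v ! k = Suc j.
       \<Prod>l<k. M $$ (v ! l - 1, v ! Suc l - 1))"
  using ij(2)
proof (induction k arbitrary: j)
  case 0
  have "{v. length v = Suc 0 \<and> set v \<subseteq> {1..n} \<and> v ! 0 = Suc i \<and> v ! 0 = Suc j} =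
      (if i = j then {[Suc i]} else {})"
    using ij by (auto simp: length_Suc_conv)
  then show ?case using M ij 0 by auto
next
  case (Suc k)
  define W where "W k j = {v. length v = Suc k \<and> set v \<subseteq> {1..n} \<and> v ! 0 = Suc i \<and> v ! k = Suc j}"
    for k j
  have finW: "finite (W k j)" for k j
    by (rule finite_subset[OF _ finite_lists_length_eq[of "{1..n}" "Suc k"]]) (auto simp: W_def)
  have W_Suc: "W (Suc k) j = (\<lambda>(l, v). v @ [Suc j]) ` (SIGMA l:{..<n}. W k l)"
  proof (intro equalityI subsetI)
    fix v assume v: "v \<in> W (Suc k) j"
    then have "v \<noteq> []" by (auto simp: W_def)
    then obtain u x where u: "v = u @ [x]" by (metis rev_exhaust)
    have lu: "length u = Suc k" using v u by (auto simp: W_def)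
    have "set u \<subseteq> {1..n}" using v u by (auto simp: W_def)
    then have uk: "u ! k \<in> {1..n}" using lu by (intro nth_mem_subset) auto
    have "x = Suc j" using v u lu by (simp add: W_def nth_append)
    moreover have "u ! 0 = Suc i" using v u lu by (simp add: W_def nth_append)
    ultimately have "v = (\<lambda>(l, v). v @ [Suc j]) (u ! k - 1, u)"
      "(u ! k - 1, u) \<in> (SIGMA l:{..<n}. W k l)"
      using uk u lu v by (auto simp: W_def)
    then show "v \<in> (\<lambda>(l, v). v @ [Suc j]) ` (SIGMA l:{..<n}. W k l)" by (rule image_eqI)
  next
    fix v assume "v \<in> (\<lambda>(l, v). v @ [Suc j]) ` (SIGMA l:{..<n}. W k l)"
    then obtain l u where "v = u @ [Suc j]" "u \<in> W k l" by auto
    then show "v \<in> W (Suc k) j" using Suc.prems unfolding W_def by (simp add: nth_append)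
  qed
  have inj: "inj_on (\<lambda>(l, v). v @ [Suc j]) (SIGMA l:{..<n}. W k l)"
    by (auto simp: inj_on_def W_def)
  have "(\<Sum>v\<in>W (Suc k) j. \<Prod>l<Suc k. M $$ (v ! l - 1, v ! Suc l - 1)) =
      (\<Sum>(b, v)\<in>(SIGMA l:{..<n}. W k l).
        \<Prod>l<Suc k. M $$ ((v @ [Suc j]) ! l - 1, (v @ [Suc j]) ! Suc l - 1))"
    unfolding W_Suc by (subst sum.reindex[OF inj]) (simp add: case_prod_unfold)
  also have "\<dots> = (\<Sum>(b, v)\<in>(SIGMA l:{..<n}. W k l).
        (\<Prod>l<k. M $$ (v ! l - 1, v ! Suc l - 1)) * M $$ (b, j))"
  proof (intro sum.cong refl, clarify)
    fix b v assume v: "v \<in> W k b"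
    have "(\<Prod>l<k. M $$ ((v @ [Suc j]) ! l - 1, (v @ [Suc j]) ! Suc l - 1)) =
        (\<Prod>l<k. M $$ (v ! l - 1, v ! Suc l - 1))"
      using v by (intro prod.cong) (auto simp: W_def nth_append)
    then show "(\<Prod>l<Suc k. M $$ ((v @ [Suc j]) ! l - 1, (v @ [Suc j]) ! Suc l - 1)) =
        (\<Prod>l<k. M $$ (v ! l - 1, v ! Suc l - 1)) * M $$ (b, j)"
      using v by (simp add: W_def nth_append)
  qed
  also have "\<dots> = (\<Sum>b<n. \<Sum>v\<in>W k b. (\<Prod>l<k. M $$ (v ! l - 1, v ! Suc l - 1)) * M $$ (b, j))"
    using finW by (subst sum.Sigma) auto
  also have "\<dots> = (\<Sum>b<n. (M ^\<^sub>m k) $$ (i, b) * M $$ (b, j))"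
    using Suc.IH by (intro sum.cong) (auto simp: W_def sum_distrib_right)
  also have "\<dots> = (M ^\<^sub>m Suc k) $$ (i, j)"
    using M ij Suc.prems by (auto simp: scalar_prod_def atLeast0LessThan intro!: sum.cong)
  finally show ?case by (simp add: W_def)
qed

text \<open>The expansion of the power also runs over lists with equal neighbours; the zero diagonal
  removes exactly the lists that are not paths.\<close>

lemma trace_pow_eq_sum_closed_paths:
  fixes M :: "'a :: comm_semiring_1 mat"
  assumes M: "M \<in> carrier_mat n n" and diag: "\<And>i. i < n \<Longrightarrow> M $$ (i, i) = 0" and k: "k \<ge> 1"
  shows "(\<Sum>i<n. (M ^\<^sub>m k) $$ (i, i)) =
    (\<Sum>v\<in>closed_paths k n. \<Prod>l<k. M $$ (v ! l - 1, v ! Suc l - 1))"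
proof -
  define W where "W i = {v. length v = Suc k \<and> set v \<subseteq> {1..n} \<and> v ! 0 = Suc i \<and> v ! k = Suc i}"
    for i
  define U where "U = {v. length v = Suc k \<and> set v \<subseteq> {1..n} \<and> v ! k = v ! 0}"
  have finU: "finite U"
    by (rule finite_subset[OF _ finite_lists_length_eq[of "{1..n}" "Suc k"]]) (auto simp: U_def)
  have U: "U = (\<Union>i\<in>{..<n}. W i)"
  proof (intro equalityI subsetI)
    fix v assume v: "v \<in> U"
    then have "v ! 0 \<in> {1..n}" unfolding U_def by (intro nth_mem_subset) auto
    then have "v \<in> W (v ! 0 - 1)" "v ! 0 - 1 < n" using v by (auto simp: U_def W_def)
    then show "v \<in> (\<Union>i\<in>{..<n}. W i)" by blast
  qed (auto simp: U_def W_def)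
  have "(\<Sum>i<n. (M ^\<^sub>m k) $$ (i, i)) = (\<Sum>i<n. \<Sum>v\<in>W i. \<Prod>l<k. M $$ (v ! l - 1, v ! Suc l - 1))"
    using pow_mat_entry_eq_sum_paths[OF M] by (intro sum.cong) (auto simp: W_def)
  also have "\<dots> = (\<Sum>v\<in>U. \<Prod>l<k. M $$ (v ! l - 1, v ! Suc l - 1))"
    unfolding U using finU U by (intro sum.UNION_disjoint[symmetric]) (auto simp: W_def)
  also have "\<dots> = (\<Sum>v\<in>closed_paths k n. \<Prod>l<k. M $$ (v ! l - 1, v ! Suc l - 1))"
  proof (intro sum.mono_neutral_right finU ballI)
    show "closed_paths k n \<subseteq> U" by (auto simp: closed_paths_def is_path_def U_def)
    fix v assume v: "v \<in> U - closed_paths k n"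
    then obtain l where l: "l < k" "v ! l = v ! Suc l"
      using k by (auto simp: U_def closed_paths_def is_path_def)
    have "v ! l \<in> {1..n}" using v l(1) unfolding U_def by (intro nth_mem_subset) auto
    then have "M $$ (v ! l - 1, v ! Suc l - 1) = 0" using l(2) diag[of "v ! l - 1"] by force
    then show "(\<Prod>l<k. M $$ (v ! l - 1, v ! Suc l - 1)) = 0"
      using l(1) by (intro prod_zero) blast+
  qed
  finally show ?thesis .
qed

lemma walk_mat_entry:
  assumes c: "c > 0" and i: "i < n" and j: "j < n"
  shows "walk_mat c n (V, {e \<in> vertex_pairs n. f e}) $$ (i, j) =
    of_bool (i \<noteq> j \<and> f {Suc i, Suc j}) / (c + real (vertex_degree n f (Suc i)))"
proof -
  let ?G = "(V, {e \<in> vertex_pairs n. f e})"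
  have A: "adjacency_mat n ?G $$ (i, l) = of_bool (i \<noteq> l \<and> f {Suc i, Suc l})" if "l < n" for l
    using i that by (auto simp: adjacency_mat_def doubleton_in_vertex_pairs)
  have "(\<Sum>l<n. adjacency_mat n ?G $$ (i, l)) = (\<Sum>l<n. of_bool (i \<noteq> l \<and> f {Suc i, Suc l}))"
    using A by (intro sum.cong) auto
  also have "\<dots> = real (card {l \<in> {..<n}. i \<noteq> l \<and> f {Suc i, Suc l}})"
    by (simp add: sum.If_cases of_bool_def Int_def)
  also have "card {l \<in> {..<n}. i \<noteq> l \<and> f {Suc i, Suc l}} = vertex_degree n f (Suc i)"
    unfolding vertex_degree_def
    by (rule bij_betw_same_card[of Suc], rule bij_betw_byWitness[of _ "\<lambda>w. w - 1"]) (auto simp: Suc_le_eq)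
  finally show ?thesis using i j A by (simp add: walk_mat_eq[OF c])
qed

lemma expectation_trace_walk_mat:
  assumes c: "c > 0" and k: "k \<ge> 1"
  shows "measure_pmf.expectation (erdos_renyi n a) (\<lambda>G. \<Sum>i<n. (walk_mat c n G ^\<^sub>m k) $$ (i, i)) =
    (\<Sum>v\<in>closed_paths k n. measure_pmf.expectation (edge_pmf n a) (path_weight c n v))"
proof -
  have "(\<Sum>i<n. (walk_mat c n ({1..n}, {e \<in> vertex_pairs n. f e}) ^\<^sub>m k) $$ (i, i)) =
      (\<Sum>v\<in>closed_paths k n. path_weight c n v f)" for f
  proof (subst trace_pow_eq_sum_closed_paths[OF _ _ k], goal_cases)
    case 1
    show ?case by (simp add: walk_mat_eq[OF c])
  next
    case (2 i)
    then show ?case by (simp add: walk_mat_entry[OF c])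
  next
    case 3
    show ?case
    proof (intro sum.cong refl)
      fix v assume "v \<in> closed_paths k n"
      then have v: "length v = Suc k" "set v \<subseteq> {1..n}" "\<And>l. l < k \<Longrightarrow> v ! l \<noteq> v ! Suc l"
        by (auto simp: closed_paths_def is_path_def)
      have mem: "v ! l \<in> {1..n}" if "l \<le> k" for l
        using v(1,2) that by (intro nth_mem_subset) auto
      show "(\<Prod>l<k. walk_mat c n ({1..n}, {e \<in> vertex_pairs n. f e}) $$ (v ! l - 1, v ! Suc l - 1)) =
          path_weight c n v f"
        unfolding path_weight_def v(1) diff_Suc_1
      proof (intro prod.cong refl)
        fix l assume "l \<in> {..<k}"
        then have l: "l < k" "v ! l \<in> {1..n}" "v ! Suc l \<in> {1..n}" "v ! l \<noteq> v ! Suc l"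
          using mem[of l] mem[of "Suc l"] v(3) by auto
        then have "v ! l - 1 < n" "v ! Suc l - 1 < n" "v ! l - 1 \<noteq> v ! Suc l - 1"
          "Suc (v ! l - 1) = v ! l" "Suc (v ! Suc l - 1) = v ! Suc l" by auto
        then show "walk_mat c n ({1..n}, {e \<in> vertex_pairs n. f e}) $$ (v ! l - 1, v ! Suc l - 1) =
            of_bool (f {v ! l, v ! Suc l}) / (c + real (vertex_degree n f (v ! l)))"
          by (simp add: walk_mat_entry[OF c])
      qed
    qed
  qed
  then show ?thesis
    by (simp add: erdos_renyi_eq Bochner_Integration.integral_sum integrable_edge_pmf)
qed

section \<open>Invariance of expected weights under relabelling\<close>

lemma path_weight_permute:
  assumes s: "\<sigma> permutes {1..n}"
  shows "path_weight c n (map \<sigma> v) f = path_weight c n v (\<lambda>e. f (\<sigma> ` e))"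
proof -
  have "vertex_degree n f (\<sigma> u) = vertex_degree n (\<lambda>e. f (\<sigma> ` e)) u" for u
  proof -
    have "inj \<sigma>" by (rule permutes_inj[OF s])
    have "{w \<in> {1..n}. w \<noteq> \<sigma> u \<and> f {\<sigma> u, w}} = {w \<in> \<sigma> ` {1..n}. w \<noteq> \<sigma> u \<and> f {\<sigma> u, w}}"
      by (simp only: permutes_image[OF s])
    also have "\<dots> = \<sigma> ` {w \<in> {1..n}. w \<noteq> u \<and> f (\<sigma> ` {u, w})}"
      using inj_eq[OF \<open>inj \<sigma>\<close>] by auto
    finally show ?thesis
      unfolding vertex_degree_def using \<open>inj \<sigma>\<close> by (simp add: card_image inj_on_def)
  qed
  then show ?thesis unfolding path_weight_def by (intro prod.cong) auto
qed

text \<open>A permutation of the vertices permutes the pairs, and the coordinates of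
  \<open>edge_pmf\<close> are independent and identically distributed, so composing with it leaves
  the law unchanged.\<close>

lemma expectation_path_weight_permute:
  assumes s: "\<sigma> permutes {1..n}"
  shows "measure_pmf.expectation (edge_pmf n a) (path_weight c n (map \<sigma> v)) =
    measure_pmf.expectation (edge_pmf n a) (path_weight c n v)"
proof -
  have bij: "bij ((`) \<sigma>)" using permutes_bij[OF s] by (simp add: bij_betw_Pow flip: Pow_UNIV)
  have mem: "\<sigma> ` e \<in> vertex_pairs n \<longleftrightarrow> e \<in> vertex_pairs n" for e
  proof -
    have "card (\<sigma> ` e) = card e" using permutes_inj[OF s] by (intro card_image) (auto simp: inj_on_def)
    moreover have "\<sigma> ` e \<subseteq> {1..n} \<longleftrightarrow> e \<subseteq> {1..n}"
      using permutes_in_image[OF s] by (auto simp del: atLeastAtMost_iff)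
    ultimately show ?thesis by (simp add: vertex_pairs_def)
  qed
  have "bij_betw ((`) \<sigma>) (vertex_pairs n) (vertex_pairs n)"
    unfolding bij_betw_def
  proof (intro conjI equalityI subsetI)
    show "inj_on ((`) \<sigma>) (vertex_pairs n)" using bij by (meson bij_is_inj inj_on_subset subset_UNIV)
    show "e \<in> vertex_pairs n" if "e \<in> (`) \<sigma> ` vertex_pairs n" for e
      using that mem by blast
    show "e \<in> (`) \<sigma> ` vertex_pairs n" if e: "e \<in> vertex_pairs n" for e
    proof -
      obtain d where "e = \<sigma> ` d" using bij by (metis bij_pointE)
      then show ?thesis using e mem by blast
    qed
  qed
  then have "edge_pmf n a = map_pmf (\<lambda>g. g \<circ> (`) \<sigma>) (edge_pmf n a)"
    unfolding edge_pmf_def using mem by (intro Pi_pmf_bij_betw finite_vertex_pairs) auto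
  then have "measure_pmf.expectation (edge_pmf n a) (path_weight c n v) =
      measure_pmf.expectation (map_pmf (\<lambda>g. g \<circ> (`) \<sigma>) (edge_pmf n a)) (path_weight c n v)"
    by (rule arg_cong)
  then show ?thesis by (simp add: path_weight_permute[OF s, abs_def] comp_def)
qed

text \<open>\<open>A\<close> and its image have complements of equal size in \<open>S\<close>; any
  bijection between these completes \<open>g\<close>. A relabelling, which is given only on
  \<open>{1..t}\<close>, thereby becomes a symmetry of the whole graph.\<close>

lemma inj_on_extends_to_permutation:
  assumes S: "finite S" and A: "A \<subseteq> S" and g: "inj_on g A" "g ` A \<subseteq> S"
  shows "\<exists>\<sigma>. \<sigma> permutes S \<and> (\<forall>x\<in>A. \<sigma> x = g x)"
proof -
  have "card (S - A) = card (S - g ` A)"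
    using S A g by (simp add: card_Diff_subset finite_subset card_image)
  then obtain h where h: "bij_betw h (S - A) (S - g ` A)"
    using S by (metis finite_Diff finite_same_card_bij)
  define \<sigma> where "\<sigma> x = (if x \<in> A then g x else if x \<in> S then h x else x)" for x
  have "bij_betw \<sigma> A (g ` A)" using g by (auto simp: bij_betw_def \<sigma>_def inj_on_def)
  moreover have "bij_betw \<sigma> (S - A) (S - g ` A)"
    using h by (subst bij_betw_cong[of _ _ h]) (auto simp: \<sigma>_def)
  ultimately have "bij_betw \<sigma> (A \<union> (S - A)) (g ` A \<union> (S - g ` A))"
    by (rule bij_betw_combine) auto
  then have "bij_betw \<sigma> S S" using A g by (simp add: Un_absorb1)
  then have "\<sigma> permutes S" using A by (intro bij_imp_permutes) (auto simp: \<sigma>_def)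
  then show ?thesis by (auto simp: \<sigma>_def)
qed

lemma expectation_path_weight_relabel:
  assumes xs: "distinct xs" "set xs \<subseteq> {1..n}" and i: "set i = {1..length xs}"
  shows "measure_pmf.expectation (edge_pmf n a) (path_weight c n (relabel xs i)) =
    measure_pmf.expectation (edge_pmf n a) (path_weight c n i)"
proof -
  have "length xs \<le> n" using distinct_card[OF xs(1)] card_mono[OF _ xs(2)] by simp
  moreover have "(\<lambda>b. xs ! (b - 1)) ` {1..length xs} \<subseteq> {1..n}"
  proof (rule image_subsetI)
    fix b assume "b \<in> {1..length xs}"
    then have "xs ! (b - 1) \<in> set xs" by (intro nth_mem) auto
    then show "xs ! (b - 1) \<in> {1..n}" using xs(2) by blast
  qed
  ultimately obtain \<sigma> where s: "\<sigma> permutes {1..n}" "\<forall>b\<in>{1..length xs}. \<sigma> b = xs ! (b - 1)"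
    using inj_on_extends_to_permutation[OF _ _ relabel_inj_on[OF xs(1)], of "{1..n}"] by auto
  have "relabel xs i = map \<sigma> i" unfolding relabel_def using s(2) i by (intro map_cong) auto
  then show ?thesis using expectation_path_weight_permute[OF s(1)] by simp
qed

section \<open>Weights of canonical paths\<close>

text \<open>The factor of vertex \<open>u\<close> when \<open>y\<close> edges leave \<open>u\<close>
  for vertices outside the path and the only edges at \<open>u\<close> inside are those of the path.
  Averaged over a Poisson \<open>y\<close> it is a factor of the claimed formula.\<close>

definition vertex_factor :: "real \<Rightarrow> nat list \<Rightarrow> nat \<Rightarrow> nat \<Rightarrow> real" where
  "vertex_factor c i u y =
     (c + real (degree_in u (path_graph i)) + real y) powi (- int (n_plus u i))"

lemma canonical_closed_pathsD:
  assumes "i \<in> canonical_closed_paths k t"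
  shows "k \<ge> 1" "length i = Suc k" "set i = {1..t}" "\<And>j. j < k \<Longrightarrow> i ! j \<noteq> i ! Suc j"
    "is_path {1..t} k i" "i ! k = i ! 0"
  using assms by (auto simp: canonical_closed_paths_def closed_paths_def is_path_def)

lemma path_edges_vertex_pairs:
  assumes "i \<in> canonical_closed_paths k t"
  shows "path_edges i \<subseteq> vertex_pairs t"
proof
  fix e assume "e \<in> path_edges i"
  then obtain j where j: "j < k" "e = {i ! j, i ! Suc j}"
    using canonical_closed_pathsD(2)[OF assms] by (auto simp: path_edges_eq_image)
  have "i ! j \<in> {1..t}" "i ! Suc j \<in> {1..t}"
    using canonical_closed_pathsD(2,3)[OF assms] j by (auto intro!: nth_mem_subset simp del: atLeastAtMost_iff)
  then show "e \<in> vertex_pairs t"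
    using canonical_closed_pathsD(4)[OF assms j(1)] j(2) by (simp only: doubleton_in_vertex_pairs) blast
qed

text \<open>Group the steps by their starting vertex: \<open>u\<close> contributes its inverse
  shifted degree once for each departure, and the 0-1 numerators merge into the event that all path
  edges are present.\<close>

lemma path_weight_canonical:
  assumes i: "i \<in> canonical_closed_paths k t"
  shows "path_weight c n i f = of_bool (\<forall>e\<in>path_edges i. f e) *
    (\<Prod>u = 1..t. (c + real (vertex_degree n f u)) powi (- int (n_plus u i)))"
proof -
  note D = canonical_closed_pathsD[OF i]
  define h where "h u = 1 / (c + real (vertex_degree n f u))" for u
  have "path_weight c n i f = (\<Prod>j<k. of_bool (f {i ! j, i ! Suc j})) * (\<Prod>j<k. h (i ! j))"
    by (simp add: path_weight_def D(2) h_def prod_dividef)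
  also have "(\<Prod>j<k. of_bool (f {i ! j, i ! Suc j})) = (of_bool (\<forall>e\<in>path_edges i. f e) :: real)"
    by (cases "\<forall>e\<in>path_edges i. f e") (auto simp: path_edges_eq_image D(2))
  also have "(\<Prod>j<k. h (i ! j)) = (\<Prod>u\<in>{1..t}. \<Prod>j\<in>{j\<in>{..<k}. i ! j = u}. h (i ! j))"
    using D(2,3) by (intro prod.group[symmetric])
      (auto intro!: nth_mem_subset simp del: atLeastAtMost_iff)
  also have "\<dots> = (\<Prod>u\<in>{1..t}. (c + real (vertex_degree n f u)) powi (- int (n_plus u i)))"
  proof (intro prod.cong refl)
    fix u
    have "n_plus u i = card {j \<in> {..<k}. i ! j = u}"
      unfolding n_plus_def using D(2) by (intro arg_cong[of _ _ card]) auto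
    moreover have "(\<Prod>j\<in>{j\<in>{..<k}. i ! j = u}. h (i ! j)) = (\<Prod>j\<in>{j\<in>{..<k}. i ! j = u}. h u)"
      by (intro prod.cong) auto
    ultimately show "(\<Prod>j\<in>{j\<in>{..<k}. i ! j = u}. h (i ! j)) =
        (c + real (vertex_degree n f u)) powi (- int (n_plus u i))"
      by (simp add: h_def power_int_minus divide_inverse power_inverse)
  qed
  finally show ?thesis .
qed

lemma card_pairs_through_vertex:
  assumes E: "E \<subseteq> vertex_pairs t"
  shows "card {w \<in> {1..t}. w \<noteq> u \<and> {u, w} \<in> E} = card {e \<in> E. u \<in> e}"
proof (rule bij_betw_same_card)
  show "bij_betw (\<lambda>w. {u, w}) {w \<in> {1..t}. w \<noteq> u \<and> {u, w} \<in> E} {e \<in> E. u \<in> e}"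
    unfolding bij_betw_def
  proof (intro conjI equalityI subsetI)
    fix e assume e: "e \<in> {e \<in> E. u \<in> e}"
    then have "e \<in> vertex_pairs t" using E by auto
    then obtain x y where xy: "e = {x, y}" "x \<noteq> y" "e \<subseteq> {1..t}"
      by (auto simp: vertex_pairs_def card_2_iff)
    then show "e \<in> (\<lambda>w. {u, w}) ` {w \<in> {1..t}. w \<noteq> u \<and> {u, w} \<in> E}"
      using e by (cases "u = x") (auto simp: insert_commute)
  qed (auto simp: inj_on_def doubleton_eq_iff)
qed

text \<open>The vertices of a canonical path are \<open>1, \<dots>, t\<close>, so these are the pairs joining \<open>u\<close> to the
  vertices outside the path.\<close>
definition outer_pairs :: "nat \<Rightarrow> nat \<Rightarrow> nat \<Rightarrow> nat set set" where
  "outer_pairs t n u = (\<lambda>w. {u, w}) ` {t<..n}"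

lemma vertex_degree_split:
  assumes "t \<le> n" "u \<in> {1..t}"
  shows "vertex_degree n f u =
    card {w \<in> {1..t}. w \<noteq> u \<and> f {u, w}} + card {e \<in> outer_pairs t n u. f e}"
proof -
  have split: "{w \<in> {1..n}. w \<noteq> u \<and> f {u, w}} =
      {w \<in> {1..t}. w \<noteq> u \<and> f {u, w}} \<union> {w \<in> {t<..n}. f {u, w}}"
    using assms by auto
  have "vertex_degree n f u =
      card {w \<in> {1..t}. w \<noteq> u \<and> f {u, w}} + card {w \<in> {t<..n}. f {u, w}}"
    unfolding vertex_degree_def split by (intro card_Un_disjoint) auto
  also have "card {w \<in> {t<..n}. f {u, w}} = card ((\<lambda>w. {u, w}) ` {w \<in> {t<..n}. f {u, w}})"
    by (intro card_image[symmetric]) (auto simp: inj_on_def doubleton_eq_iff)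
  also have "(\<lambda>w. {u, w}) ` {w \<in> {t<..n}. f {u, w}} = {e \<in> outer_pairs t n u. f e}"
    by (auto simp: outer_pairs_def)
  finally show ?thesis .
qed

text \<open>The second bound does not involve \<open>y\<close>, so it serves as the constant
  \<open>B\<close> in the passage from binomial to Poisson expectations.\<close>

lemma vertex_factor_bounds:
  assumes "c > 0"
  shows "0 \<le> vertex_factor c i u y" "\<bar>vertex_factor c i u y\<bar> \<le> inverse (c ^ n_plus u i)"
proof -
  show *: "0 \<le> vertex_factor c i u y"
    using assms by (auto simp: vertex_factor_def intro!: zero_le_power_int)
  have "c ^ n_plus u i \<le> (c + real (degree_in u (path_graph i)) + real y) ^ n_plus u i"
    using assms by (intro power_mono) auto
  then show "\<bar>vertex_factor c i u y\<bar> \<le> inverse (c ^ n_plus u i)"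
    using assms * by (simp add: vertex_factor_def power_int_minus le_imp_inverse_le)
qed

text \<open>The vertex factors are decreasing in the degree. Ignoring the pairs inside \<open>{1..t}\<close> that are not
  edges of the path bounds the weight from above; requiring them to be absent bounds it from below. In
  both bounds all factors depend on disjoint sets of pairs.\<close>
lemma path_weight_upper:
  assumes c: "c > 0" and i: "i \<in> canonical_closed_paths k t" and tn: "t \<le> n"
  shows "path_weight c n i f \<le> of_bool ((\<forall>e\<in>path_edges i. f e) \<and> (\<forall>e\<in>{}. \<not> f e)) *
    (\<Prod>u = 1..t. vertex_factor c i u (card {e \<in> outer_pairs t n u. f e}))"
proof (cases "\<forall>e\<in>path_edges i. f e")
  case True
  have "(\<Prod>u = 1..t. (c + real (vertex_degree n f u)) powi (- int (n_plus u i))) \<le>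
      (\<Prod>u = 1..t. vertex_factor c i u (card {e \<in> outer_pairs t n u. f e}))"
  proof (intro prod_mono conjI)
    fix u assume u: "u \<in> {1..t}"
    have "degree_in u (path_graph i) = card {w \<in> {1..t}. w \<noteq> u \<and> {u, w} \<in> path_edges i}"
      using card_pairs_through_vertex[OF path_edges_vertex_pairs[OF i], of u] by (simp add: degree_in_def)
    also have "\<dots> \<le> card {w \<in> {1..t}. w \<noteq> u \<and> f {u, w}}"
      using True by (intro card_mono) auto
    finally have "degree_in u (path_graph i) + card {e \<in> outer_pairs t n u. f e} \<le> vertex_degree n f u"
      using vertex_degree_split[OF tn u] by simp
    then have "real (degree_in u (path_graph i) + card {e \<in> outer_pairs t n u. f e}) \<le>
        real (vertex_degree n f u)" by (rule of_nat_mono)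
    then have "(c + real (degree_in u (path_graph i)) + real (card {e \<in> outer_pairs t n u. f e})) ^ n_plus u i
        \<le> (c + real (vertex_degree n f u)) ^ n_plus u i"
      using c by (intro power_mono) auto
    then show "(c + real (vertex_degree n f u)) powi (- int (n_plus u i)) \<le>
        vertex_factor c i u (card {e \<in> outer_pairs t n u. f e})"
      using c by (auto simp: vertex_factor_def power_int_minus intro!: le_imp_inverse_le zero_less_power add_pos_nonneg)
    show "0 \<le> (c + real (vertex_degree n f u)) powi (- int (n_plus u i))"
      using c by (intro zero_le_power_int) auto
  qed
  then show ?thesis using True by (simp add: path_weight_canonical[OF i])
next
  case False
  then show ?thesis using c by (auto simp: path_weight_canonical[OF i])
qed

lemma path_weight_lower:
  assumes c: "c > 0" and i: "i \<in> canonical_closed_paths k t" and tn: "t \<le> n"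
  shows "of_bool ((\<forall>e\<in>path_edges i. f e) \<and> (\<forall>e\<in>vertex_pairs t - path_edges i. \<not> f e)) *
    (\<Prod>u = 1..t. vertex_factor c i u (card {e \<in> outer_pairs t n u. f e})) \<le> path_weight c n i f"
proof (cases "(\<forall>e\<in>path_edges i. f e) \<and> (\<forall>e\<in>vertex_pairs t - path_edges i. \<not> f e)")
  case True
  \<comment> \<open>On this event the graph induced on \<open>{1..t}\<close> is exactly the path
    graph, so the bound is attained.\<close>
  have "vertex_factor c i u (card {e \<in> outer_pairs t n u. f e}) =
      (c + real (vertex_degree n f u)) powi (- int (n_plus u i))" if u: "u \<in> {1..t}" for u
  proof -
    have "f {u, w} \<longleftrightarrow> {u, w} \<in> path_edges i" if "w \<in> {1..t}" "w \<noteq> u" for w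
      using True that u doubleton_in_vertex_pairs[of u w t] by blast
    then have "{w \<in> {1..t}. w \<noteq> u \<and> f {u, w}} = {w \<in> {1..t}. w \<noteq> u \<and> {u, w} \<in> path_edges i}"
      by blast
    then have "vertex_degree n f u = degree_in u (path_graph i) + card {e \<in> outer_pairs t n u. f e}"
      using vertex_degree_split[OF tn u, of f]
        card_pairs_through_vertex[OF path_edges_vertex_pairs[OF i], of u] by (simp add: degree_in_def)
    then show ?thesis by (simp add: vertex_factor_def add.assoc)
  qed
  then show ?thesis using True by (simp add: path_weight_canonical[OF i])
next
  case False
  have "0 \<le> path_weight c n i f"
    using c by (auto simp: path_weight_def intro!: prod_nonneg)
  then show ?thesis by (simp only: False of_bool_eq mult_zero_left)
qed

text \<open>The outer pairs at different path vertices are disjoint from each other and from the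
  pairs inside \<open>{1..t}\<close>, so the vertices can be split off one at a time.\<close>

lemma expectation_inner_outer:
  assumes tn: "t \<le> n" and U: "U \<subseteq> {1..t}"
    and h: "\<And>f g. (\<And>e. e \<in> vertex_pairs t \<Longrightarrow> f e = g e) \<Longrightarrow> h f = h g"
  shows "measure_pmf.expectation (edge_pmf n a)
      (\<lambda>f. h f * (\<Prod>u\<in>U. G u (card {e \<in> outer_pairs t n u. f e}))) =
    measure_pmf.expectation (edge_pmf n a) h *
      (\<Prod>u\<in>U. measure_pmf.expectation (edge_pmf n a) (\<lambda>f. G u (card {e \<in> outer_pairs t n u. f e}) :: real))"
proof -
  have "finite U" using U by (rule finite_subset) simp
  then show ?thesis using U
  proof (induction U)
    case (insert u U)
    let ?O = "outer_pairs t n"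
    have u: "u \<in> {1..t}" and U: "U \<subseteq> {1..t}" using insert by auto
    have inner: "vertex_pairs t \<subseteq> vertex_pairs n" using tn by (auto simp: vertex_pairs_def)
    have outer: "?O x \<subseteq> vertex_pairs n" if "x \<in> {1..t}" for x
      using that tn by (auto simp: outer_pairs_def vertex_pairs_def)
    have disj1: "?O u \<inter> vertex_pairs t = {}" by (auto simp: outer_pairs_def vertex_pairs_def)
    have disj2: "?O u \<inter> ?O x = {}" if "x \<in> U" for x
      using that insert u by (auto simp: outer_pairs_def doubleton_eq_iff)
    have "measure_pmf.expectation (edge_pmf n a)
        (\<lambda>f. G u (card {e \<in> ?O u. f e}) * (h f * (\<Prod>u\<in>U. G u (card {e \<in> ?O u. f e})))) =
      measure_pmf.expectation (edge_pmf n a) (\<lambda>f. G u (card {e \<in> ?O u. f e})) *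
      measure_pmf.expectation (edge_pmf n a) (\<lambda>f. h f * (\<Prod>u\<in>U. G u (card {e \<in> ?O u. f e})))"
      unfolding edge_pmf_def
    proof (rule expectation_Pi_pmf_mult[OF finite_vertex_pairs outer[OF u]])
      fix f g :: "nat set \<Rightarrow> bool" assume "\<And>e. e \<in> ?O u \<Longrightarrow> f e = g e"
      then have "{e \<in> ?O u. f e} = {e \<in> ?O u. g e}" by auto
      then show "G u (card {e \<in> ?O u. f e}) = G u (card {e \<in> ?O u. g e})" by simp
    next
      fix f g :: "nat set \<Rightarrow> bool" assume fg: "\<And>e. e \<in> vertex_pairs n - ?O u \<Longrightarrow> f e = g e"
      have "h f = h g" using fg inner disj1 by (intro h) blast
      moreover have "{e \<in> ?O x. f e} = {e \<in> ?O x. g e}" if "x \<in> U" for x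
        using fg outer[of x] disj2[OF that] that U by blast
      ultimately show "h f * (\<Prod>u\<in>U. G u (card {e \<in> ?O u. f e})) =
          h g * (\<Prod>u\<in>U. G u (card {e \<in> ?O u. g e}))" by simp
    qed
    then show ?case using insert.hyps insert.IH[OF U] by (simp add: mult_ac)
  qed simp
qed

text \<open>One evaluation for both bounds: the upper one takes \<open>C\<close> empty, the lower
  one takes for \<open>C\<close> the inner pairs that are not path edges. Each path vertex has
  \<open>n - t\<close> outer pairs, hence the binomial parameter.\<close>

lemma expectation_pattern_vertex_factors:
  assumes a: "0 \<le> a" "a \<le> 1" and tn: "t \<le> n"
    and EC: "E \<subseteq> vertex_pairs t" "C \<subseteq> vertex_pairs t" "E \<inter> C = {}"
  shows "measure_pmf.expectation (edge_pmf n a)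
      (\<lambda>f. of_bool ((\<forall>e\<in>E. f e) \<and> (\<forall>e\<in>C. \<not> f e)) *
        (\<Prod>u = 1..t. G u (card {e \<in> outer_pairs t n u. f e}))) =
    a ^ card E * (1 - a) ^ card C *
      (\<Prod>u = 1..t. measure_pmf.expectation (binomial_pmf (n - t) a) (G u))"
proof -
  have inner: "vertex_pairs t \<subseteq> vertex_pairs n" using tn by (auto simp: vertex_pairs_def)
  have h: "of_bool ((\<forall>e\<in>E. f e) \<and> (\<forall>e\<in>C. \<not> f e)) = (of_bool ((\<forall>e\<in>E. g e) \<and> (\<forall>e\<in>C. \<not> g e)) :: real)"
    if "\<And>e. e \<in> vertex_pairs t \<Longrightarrow> f e = g e" for f g :: "nat set \<Rightarrow> bool"
  proof -
    have "(\<forall>e\<in>E. f e) = (\<forall>e\<in>E. g e)" "(\<forall>e\<in>C. \<not> f e) = (\<forall>e\<in>C. \<not> g e)"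
      using that EC by blast+
    then show ?thesis by simp
  qed
  have "measure_pmf.expectation (edge_pmf n a) (\<lambda>f. G u (card {e \<in> outer_pairs t n u. f e})) =
      measure_pmf.expectation (binomial_pmf (n - t) a) (G u)" if u: "u \<in> {1..t}" for u
  proof -
    have "card (outer_pairs t n u) = card {t<..n}"
      unfolding outer_pairs_def by (intro card_image) (auto simp: inj_on_def doubleton_eq_iff)
    moreover have "outer_pairs t n u \<subseteq> vertex_pairs n"
      using u tn by (auto simp: outer_pairs_def vertex_pairs_def)
    ultimately show ?thesis
      unfolding edge_pmf_def using expectation_Pi_bernoulli_card[OF finite_vertex_pairs _ a] by simp
  qed
  moreover have "measure_pmf.expectation (edge_pmf n a)
      (\<lambda>f. of_bool ((\<forall>e\<in>E. f e) \<and> (\<forall>e\<in>C. \<not> f e))) = a ^ card E * (1 - a) ^ card C"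
    unfolding edge_pmf_def using EC inner
    by (intro expectation_Pi_bernoulli_pattern finite_vertex_pairs a) auto
  ultimately show ?thesis
    by (subst expectation_inner_outer[OF tn order.refl h]) auto
qed

lemma expectation_path_weight_bounds:
  assumes c: "c > 0" and i: "i \<in> canonical_closed_paths k t" and tn: "t \<le> n"
    and a: "0 \<le> a" "a \<le> 1"
  defines "B \<equiv> (\<Prod>u = 1..t. measure_pmf.expectation (binomial_pmf (n - t) a) (vertex_factor c i u))"
  shows "measure_pmf.expectation (edge_pmf n a) (path_weight c n i) \<le> a ^ card (path_edges i) * B"
    and "a ^ card (path_edges i) * (1 - a) ^ card (vertex_pairs t - path_edges i) * B
      \<le> measure_pmf.expectation (edge_pmf n a) (path_weight c n i)"
proof -
  note E = path_edges_vertex_pairs[OF i]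
  have "measure_pmf.expectation (edge_pmf n a) (path_weight c n i) \<le>
      measure_pmf.expectation (edge_pmf n a)
        (\<lambda>f. of_bool ((\<forall>e\<in>path_edges i. f e) \<and> (\<forall>e\<in>{}. \<not> f e)) *
          (\<Prod>u = 1..t. vertex_factor c i u (card {e \<in> outer_pairs t n u. f e})))"
    by (intro integral_mono integrable_edge_pmf path_weight_upper[OF c i tn])
  also have "\<dots> = a ^ card (path_edges i) * B"
    unfolding B_def by (subst expectation_pattern_vertex_factors[OF a tn E]) auto
  finally show "measure_pmf.expectation (edge_pmf n a) (path_weight c n i) \<le> a ^ card (path_edges i) * B" .
  have "a ^ card (path_edges i) * (1 - a) ^ card (vertex_pairs t - path_edges i) * B =
      measure_pmf.expectation (edge_pmf n a)
        (\<lambda>f. of_bool ((\<forall>e\<in>path_edges i. f e) \<and> (\<forall>e\<in>vertex_pairs t - path_edges i. \<not> f e)) *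
          (\<Prod>u = 1..t. vertex_factor c i u (card {e \<in> outer_pairs t n u. f e})))"
    unfolding B_def by (subst expectation_pattern_vertex_factors[OF a tn E]) auto
  also have "\<dots> \<le> measure_pmf.expectation (edge_pmf n a) (path_weight c n i)"
    by (intro integral_mono integrable_edge_pmf path_weight_lower[OF c i tn])
  finally show "a ^ card (path_edges i) * (1 - a) ^ card (vertex_pairs t - path_edges i) * B
      \<le> measure_pmf.expectation (edge_pmf n a) (path_weight c n i)" .
qed

section \<open>The limit of the expected traces\<close>

lemma card_distinct_lists_tendsto:
  "(\<lambda>n. real (card {xs. length xs = t \<and> distinct xs \<and> set xs \<subseteq> {1..n}}) / real n ^ t) \<longlonglongrightarrow> 1"
proof -
  have "(\<lambda>n. \<Prod>j<t. (real n - real j) / real n) \<longlonglongrightarrow> (\<Prod>j<t. 1)"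
  proof (intro tendsto_prod)
    show "(\<lambda>n. (real n - real j) / real n) \<longlonglongrightarrow> 1" for j by real_asymp
  qed
  then have lim: "(\<lambda>n. \<Prod>j<t. (real n - real j) / real n) \<longlonglongrightarrow> 1" by simp
  have "eventually (\<lambda>n. (\<Prod>j<t. (real n - real j) / real n) =
      real (card {xs. length xs = t \<and> distinct xs \<and> set xs \<subseteq> {1..n}}) / real n ^ t) sequentially"
    using eventually_ge_at_top[of t]
  proof eventually_elim
    case (elim n)
    have "card {xs. length xs = t \<and> distinct xs \<and> set xs \<subseteq> {1..n}} = \<Prod>{n - t + 1..n}"
      using elim by (subst card_lists_distinct_length_eq) auto
    also have "\<dots> = (\<Prod>j<t. n - j)"
      by (rule prod.reindex_bij_witness[of _ "\<lambda>j. n - j" "\<lambda>j. n - j"]) (use elim in auto)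
    finally show ?case using elim by (simp add: prod_dividef of_nat_diff)
  qed
  then show ?thesis using lim by (rule Lim_transform_eventually[rotated])
qed

text \<open>Power counting: about \<open>n ^ t\<close> labellings, one \<open>1 / n\<close> from
  normalising the trace and one \<open>p / n\<close> for each edge. What remains is
  \<open>p ^ e\<close> times \<open>1 / n\<close> to the excess \<open>d = e + 1 - t\<close>, which
  is 0 exactly for trees.\<close>

lemma edge_power_tendsto:
  assumes p: "p > 0" and t: "t \<ge> 1" and e: "t \<le> Suc e"
  shows "(\<lambda>n. real n ^ t / real n * (p / real n) ^ e) \<longlonglongrightarrow> (if Suc e = t then p ^ (t - 1) else 0)"
proof -
  obtain d where d: "Suc e = t + d" using e le_Suc_ex by blast
  have "(\<lambda>n. p ^ e * (1 / real n) ^ d) \<longlonglongrightarrow> p ^ e * (0 :: real) ^ d"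
    by (intro tendsto_mult tendsto_power tendsto_const) real_asymp
  moreover have "p ^ e * (0 :: real) ^ d = (if Suc e = t then p ^ (t - 1) else 0)"
    using d by (cases "d = 0") auto
  moreover have "eventually (\<lambda>n. p ^ e * (1 / real n) ^ d = real n ^ t / real n * (p / real n) ^ e) sequentially"
    using eventually_gt_at_top[of 0]
  proof eventually_elim
    case (elim n)
    have "real n ^ t * real n ^ d = real n * real n ^ e"
      using d by (simp flip: power_add power_Suc)
    then show ?case using elim by (simp add: power_divide field_simps)
  qed
  ultimately show ?thesis by (auto elim: Lim_transform_eventually)
qed

lemma expected_path_weight_tendsto:
  assumes c: "c > 0" and p: "p > 0" and i: "i \<in> canonical_closed_paths k t" and t: "t \<ge> 1"
  shows "(\<lambda>n. real (card {xs. length xs = t \<and> distinct xs \<and> set xs \<subseteq> {1..n}}) *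
      measure_pmf.expectation (edge_pmf n (p / real n)) (path_weight c n i) / real n)
    \<longlonglongrightarrow> (if Suc (card (path_edges i)) = t then p ^ (t - 1) else 0) *
      (\<Prod>u = 1..t. measure_pmf.expectation (poisson_pmf p) (vertex_factor c i u))"
proof -
  define N where "N n = real (card {xs. length xs = t \<and> distinct xs \<and> set xs \<subseteq> {1..n}})" for n :: nat
  define e where "e = card (path_edges i)"
  define q where "q = card (vertex_pairs t - path_edges i)"
  define B where "B n = (\<Prod>u = 1..t. measure_pmf.expectation (binomial_pmf (n - t) (p / real n))
    (vertex_factor c i u))" for n
  define L where "L = (\<Prod>u = 1..t. measure_pmf.expectation (poisson_pmf p) (vertex_factor c i u))"
  define s where "s = (if Suc e = t then p ^ (t - 1) else 0)"
  define F where "F n = measure_pmf.expectation (edge_pmf n (p / real n)) (path_weight c n i)" for n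
  have B: "B \<longlonglongrightarrow> L"
    unfolding B_def L_def
    by (intro tendsto_prod expectation_binomial_tendsto_poisson[OF p vertex_factor_bounds(2)[OF c]])
  have "t \<le> Suc e"
    using card_path_edges_ge[OF canonical_closed_pathsD(5)[OF i]] canonical_closed_pathsD(3)[OF i]
    by (simp add: e_def)
  then have s: "(\<lambda>n. real n ^ t / real n * (p / real n) ^ e) \<longlonglongrightarrow> s"
    unfolding s_def using edge_power_tendsto[OF p t] by blast
  have r: "(\<lambda>n. N n / real n ^ t) \<longlonglongrightarrow> 1"
    unfolding N_def by (rule card_distinct_lists_tendsto)
  \<comment> \<open>The power \<open>real n ^ t\<close> is inserted and cancelled so that each
    factor has a limit of its own.\<close>
  have up: "(\<lambda>n. (N n / real n ^ t) * (real n ^ t / real n * (p / real n) ^ e) * B n) \<longlonglongrightarrow> 1 * s * L"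
    by (intro tendsto_mult r s B)
  have "(\<lambda>n. 1 - p / real n) \<longlonglongrightarrow> 1" by real_asymp
  then have "(\<lambda>n. (N n / real n ^ t) * (real n ^ t / real n * (p / real n) ^ e) * B n * (1 - p / real n) ^ q)
      \<longlonglongrightarrow> 1 * s * L * 1 ^ q"
    by (intro tendsto_mult r s B tendsto_power)
  then have low: "(\<lambda>n. (N n / real n ^ t) * (real n ^ t / real n * (p / real n) ^ e) * B n * (1 - p / real n) ^ q)
      \<longlonglongrightarrow> s * L" by simp
  \<comment> \<open>From such \<open>n\<close> on, \<open>p / real n\<close> is a probability and
    the graph contains the vertices \<open>1, ..., t\<close>.\<close>
  have ev: "eventually (\<lambda>n. real n > p \<and> n \<ge> t) sequentially"
    by (intro eventually_conj eventually_ge_at_top) real_asymp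
  have "(\<lambda>n. N n * F n / real n) \<longlonglongrightarrow> s * L"
  proof (rule tendsto_sandwich[OF _ _ low])
    show "(\<lambda>n. (N n / real n ^ t) * (real n ^ t / real n * (p / real n) ^ e) * B n) \<longlonglongrightarrow> s * L"
      using up by simp
    show "eventually (\<lambda>n. (N n / real n ^ t) * (real n ^ t / real n * (p / real n) ^ e) * B n * (1 - p / real n) ^ q
        \<le> N n * F n / real n) sequentially"
      using ev
    proof eventually_elim
      case (elim n)
      then have n: "real n > 0" "0 \<le> p / real n" "p / real n \<le> 1" using p by auto
      have "(p / real n) ^ e * (1 - p / real n) ^ q * B n \<le> F n"
        unfolding e_def q_def B_def F_def
        using elim n by (intro expectation_path_weight_bounds(2)[OF c i]) auto
      then have "N n / real n * ((p / real n) ^ e * (1 - p / real n) ^ q * B n) \<le> N n / real n * F n"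
        by (intro mult_left_mono) (auto simp: N_def)
      then show ?case using n by (simp add: mult_ac)
    qed
    show "eventually (\<lambda>n. N n * F n / real n \<le>
        (N n / real n ^ t) * (real n ^ t / real n * (p / real n) ^ e) * B n) sequentially"
      using ev
    proof eventually_elim
      case (elim n)
      then have n: "real n > 0" "0 \<le> p / real n" "p / real n \<le> 1" using p by auto
      have "F n \<le> (p / real n) ^ e * B n"
        unfolding e_def B_def F_def
        using elim n by (intro expectation_path_weight_bounds(1)[OF c i]) auto
      then have "N n / real n * F n \<le> N n / real n * ((p / real n) ^ e * B n)"
        by (intro mult_left_mono) (auto simp: N_def)
      then show ?case using n by (simp add: mult_ac)
    qed
  qed
  then show ?thesis by (simp add: N_def F_def s_def L_def e_def)
qed

lemma canonical_closed_paths_empty: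
  assumes "t < 2"
  shows "canonical_closed_paths k t = {}"
proof (rule ccontr)
  assume "canonical_closed_paths k t \<noteq> {}"
  then obtain i where i: "i \<in> canonical_closed_paths k t" by blast
  note D = canonical_closed_pathsD[OF i]
  have "i ! 0 \<in> {1..t}" "i ! 1 \<in> {1..t}" "i ! 0 \<noteq> i ! 1"
    using D(1,2,3) D(4)[of 0] by (auto intro!: nth_mem_subset simp del: atLeastAtMost_iff)
  then show False using assms by auto
qed

lemma expected_trace_tendsto:
  assumes c: "c > 0" and p: "p > 0" and m: "m \<ge> 1" and k: "k = 2 * m"
  shows "(\<lambda>n. measure_pmf.expectation (erdos_renyi n (p / real n))
      (\<lambda>G. (\<Sum>i<n. (walk_mat c n G ^\<^sub>m k) $$ (i, i)) / real n)) \<longlonglongrightarrow>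
    (\<Sum>t = 2..m + 1. p ^ (t - 1) * (\<Sum>i\<in>Gamma_paths k t. \<Prod>u = 1..t.
      measure_pmf.expectation (poisson_pmf p) (vertex_factor c i u)))"
proof -
  have k1: "k \<ge> 1" using m k by simp
  define D where "D t n = {xs. length xs = t \<and> distinct xs \<and> set xs \<subseteq> {1..n}}" for t n :: nat
  have finD: "finite (D t n)" for t n
    by (rule finite_subset[OF _ finite_lists_length_eq[of "{1..n}" t]]) (auto simp: D_def)
  define F where "F n v = measure_pmf.expectation (edge_pmf n (p / real n)) (path_weight c n v)" for n v
  define L where "L t i = (\<Prod>u = 1..t. measure_pmf.expectation (poisson_pmf p) (vertex_factor c i u))"
    for t i
  have sum: "measure_pmf.expectation (erdos_renyi n (p / real n))
      (\<lambda>G. (\<Sum>i<n. (walk_mat c n G ^\<^sub>m k) $$ (i, i)) / real n) =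
    (\<Sum>t\<le>Suc k. \<Sum>i\<in>canonical_closed_paths k t. real (card (D t n)) * F n i / real n)" for n
  proof -
    have "(\<Sum>v\<in>closed_paths k n. F n v) =
        (\<Sum>(t, i, xs)\<in>(SIGMA t:{..Suc k}. canonical_closed_paths k t \<times> D t n). F n (relabel xs i))"
      unfolding D_def by (subst sum.reindex_bij_betw[OF bij_betw_relabel, symmetric])
        (simp add: case_prod_unfold)
    \<comment> \<open>By symmetry the expectation forgets the labelling \<open>xs\<close>, so the
      sum over labellings becomes the factor \<open>card (D t n)\<close>.\<close>
    also have "\<dots> = (\<Sum>(t, i, xs)\<in>(SIGMA t:{..Suc k}. canonical_closed_paths k t \<times> D t n). F n i)"
      by (intro sum.cong) (auto simp: F_def D_def canonical_closed_paths_def expectation_path_weight_relabel)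
    also have "\<dots> = (\<Sum>t\<le>Suc k. \<Sum>(i, xs)\<in>canonical_closed_paths k t \<times> D t n. F n i)"
      by (subst sum.Sigma) (auto simp: finD finite_canonical_closed_paths case_prod_unfold)
    also have "\<dots> = (\<Sum>t\<le>Suc k. \<Sum>i\<in>canonical_closed_paths k t. real (card (D t n)) * F n i)"
      by (simp add: sum.cartesian_product[symmetric])
    finally show ?thesis
      unfolding integral_divide_zero expectation_trace_walk_mat[OF c k1] F_def[symmetric]
      by (simp only: sum_divide_distrib)
  qed
  \<comment> \<open>The index sets are finite and no longer depend on \<open>n\<close>, so the limit
    is taken term by term.\<close>
  have "(\<lambda>n. \<Sum>t\<le>Suc k. \<Sum>i\<in>canonical_closed_paths k t. real (card (D t n)) * F n i / real n)
    \<longlonglongrightarrow> (\<Sum>t\<le>Suc k. \<Sum>i\<in>canonical_closed_paths k t.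
      (if Suc (card (path_edges i)) = t then p ^ (t - 1) else 0) * L t i)"
  proof (intro tendsto_sum)
    fix t i assume i: "i \<in> canonical_closed_paths k t"
    then have "t \<ge> 1" using canonical_closed_paths_empty[of t k] by (cases "t < 2") auto
    then show "(\<lambda>n. real (card (D t n)) * F n i / real n) \<longlonglongrightarrow>
        (if Suc (card (path_edges i)) = t then p ^ (t - 1) else 0) * L t i"
      unfolding D_def F_def L_def by (rule expected_path_weight_tendsto[OF c p i])
  qed
  also have "(\<Sum>t\<le>Suc k. \<Sum>i\<in>canonical_closed_paths k t.
      (if Suc (card (path_edges i)) = t then p ^ (t - 1) else 0) * L t i) =
      (\<Sum>t\<le>Suc k. p ^ (t - 1) * (\<Sum>i\<in>Gamma_paths k t. L t i))"
  proof (intro sum.cong refl)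
    fix t
    have "(\<Sum>i\<in>canonical_closed_paths k t. (if Suc (card (path_edges i)) = t then p ^ (t - 1) else 0) * L t i) =
        (\<Sum>i\<in>canonical_closed_paths k t. if Suc (card (path_edges i)) = t then p ^ (t - 1) * L t i else 0)"
      by (intro sum.cong) auto
    also have "\<dots> = (\<Sum>i\<in>Gamma_paths k t. p ^ (t - 1) * L t i)"
      unfolding Gamma_paths_eq by (rule sum.inter_filter[symmetric]) (rule finite_canonical_closed_paths)
    finally show "(\<Sum>i\<in>canonical_closed_paths k t. (if Suc (card (path_edges i)) = t then p ^ (t - 1) else 0) * L t i) =
        p ^ (t - 1) * (\<Sum>i\<in>Gamma_paths k t. L t i)" by (simp add: sum_distrib_left)
  qed
  also have "(\<Sum>t\<le>Suc k. p ^ (t - 1) * (\<Sum>i\<in>Gamma_paths k t. L t i)) =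
      (\<Sum>t = 2..m + 1. p ^ (t - 1) * (\<Sum>i\<in>Gamma_paths k t. L t i))"
  proof (intro sum.mono_neutral_right ballI)
    fix t assume t: "t \<in> {..Suc k} - {2..m + 1}"
    have "Gamma_paths k t = {}"
    proof (cases "t < 2")
      case True
      then show ?thesis using canonical_closed_paths_empty by (auto simp: Gamma_paths_eq)
    next
      case False
      then have "t > m + 1" using t by auto
      moreover have "t \<le> m + 1" if i: "i \<in> Gamma_paths k t" for i
      proof -
        have i': "i \<in> canonical_closed_paths k t" "Suc (card (path_edges i)) = t"
          using i by (auto simp: Gamma_paths_eq)
        note D = canonical_closed_pathsD[OF i'(1)]
        have "is_tree (path_graph i)" using is_tree_path_graph_iff[OF D(5)] i'(2) D(3) by simp
        then have "2 * card (path_edges i) \<le> k" by (rule closed_tree_path_card_edges[OF D(5,6)])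
        then show ?thesis using i'(2) k by simp
      qed
      ultimately show ?thesis by force
    qed
    then show "p ^ (t - 1) * (\<Sum>i\<in>Gamma_paths k t. L t i) = 0" by simp
  qed (use k m in auto)
  finally show ?thesis unfolding sum L_def .
qed

section \<open>Passing to the limiting distribution\<close>

text \<open>Bounded convergence for laws \<open>P n\<close> that are not coupled: where the
  deviation is at most \<open>r / 2\<close> it costs at most that, and elsewhere at most
  \<open>B\<close>, on an event of small probability.\<close>

lemma expectation_tendsto_if_prob_tendsto:
  fixes X :: "nat \<Rightarrow> 'a \<Rightarrow> real"
  assumes bnd: "\<And>n \<omega>. \<bar>X n \<omega> - l\<bar> \<le> B"
    and prob: "\<And>\<epsilon>. \<epsilon> > 0 \<Longrightarrow> (\<lambda>n. measure_pmf.prob (P n) {\<omega>. \<bar>X n \<omega> - l\<bar> > \<epsilon>}) \<longlonglongrightarrow> 0"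
  shows "(\<lambda>n. measure_pmf.expectation (P n) (X n)) \<longlonglongrightarrow> l"
proof (rule LIMSEQ_I)
  fix r :: real assume r: "r > 0"
  have B: "B \<ge> 0" using bnd[of 0 undefined] by linarith
  \<comment> \<open>With \<open>B + 1\<close> in place of \<open>B\<close> the denominator is
    positive even for \<open>B = 0\<close>, and \<open>B * \<delta> < r / 2\<close> is
    strict.\<close>
  define \<delta> where "\<delta> = r / (2 * (B + 1))"
  have \<delta>: "\<delta> > 0" using r B by (simp add: \<delta>_def)
  have "eventually (\<lambda>n. measure_pmf.prob (P n) {\<omega>. \<bar>X n \<omega> - l\<bar> > r / 2} < \<delta>) sequentially"
    using prob[of "r / 2"] r \<delta> by (intro order_tendstoD) auto
  then obtain n0 where n0: "\<And>n. n \<ge> n0 \<Longrightarrow> measure_pmf.prob (P n) {\<omega>. \<bar>X n \<omega> - l\<bar> > r / 2} < \<delta>"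
    by (auto simp: eventually_sequentially)
  have "norm (measure_pmf.expectation (P n) (X n) - l) < r" if n: "n \<ge> n0" for n
  proof -
    let ?A = "{\<omega>. \<bar>X n \<omega> - l\<bar> > r / 2}"
    have int: "integrable (P n) (\<lambda>\<omega>. X n \<omega> - l)"
      using bnd by (intro measure_pmf.integrable_const_bound[of _ B]) auto
    then have intX: "integrable (P n) (X n)" using Bochner_Integration.integrable_add[OF int, of "\<lambda>_. l"] by simp
    have "norm (measure_pmf.expectation (P n) (X n) - l) =
        \<bar>measure_pmf.expectation (P n) (\<lambda>\<omega>. X n \<omega> - l)\<bar>"
      using intX by (simp add: measure_pmf.prob_space)
    also have "\<dots> \<le> measure_pmf.expectation (P n) (\<lambda>\<omega>. \<bar>X n \<omega> - l\<bar>)" by (rule integral_abs_bound)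
    also have "\<dots> \<le> measure_pmf.expectation (P n) (\<lambda>\<omega>. r / 2 + B * indicator ?A \<omega>)"
    proof (rule integral_mono)
      show "integrable (P n) (\<lambda>\<omega>. \<bar>X n \<omega> - l\<bar>)" using int by (rule integrable_abs)
      show "integrable (P n) (\<lambda>\<omega>. r / 2 + B * indicator ?A \<omega>)"
        by (intro measure_pmf.integrable_const_bound[of _ "r / 2 + B"])
          (use r B in \<open>auto simp: indicator_def\<close>)
      show "\<bar>X n \<omega> - l\<bar> \<le> r / 2 + B * indicator ?A \<omega>" for \<omega>
        using bnd[of n \<omega>] r B by (auto simp: indicator_def)
    qed
    also have "\<dots> = r / 2 + B * measure_pmf.prob (P n) ?A"
    proof -
      have "integrable (P n) (indicat_real ?A)"
        by (intro measure_pmf.integrable_const_bound[of _ 1]) auto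
      then show ?thesis by (simp add: measure_pmf.prob_space)
    qed
    also have "\<dots> \<le> r / 2 + B * \<delta>"
      using n0[OF n] B by (intro add_left_mono mult_left_mono) auto
    also have "B * \<delta> < r / 2" using B r by (simp add: \<delta>_def field_simps)
    finally show ?thesis by simp
  qed
  then show "\<exists>no. \<forall>n\<ge>no. norm (measure_pmf.expectation (P n) (X n) - l) < r" by blast
qed

text \<open>Tested against a bounded continuous function that vanishes exactly on \<open>[-1, 1]\<close>.\<close>
lemma limiting_esd_support:
  assumes c: "c > 0" and lim: "limiting_esd c p \<mu>"
  shows "AE x in \<mu>. \<bar>x\<bar> \<le> 1"
proof -
  interpret \<mu>: real_distribution \<mu> using lim by (simp add: limiting_esd_def)
  define f :: "real \<Rightarrow> real" where "f x = min 1 (max 0 (\<bar>x\<bar> - 1))" for x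
  have cont: "continuous_on UNIV f" unfolding f_def by (intro continuous_intros)
  have bnd: "\<bar>f x\<bar> \<le> 1" for x by (auto simp: f_def)
  then have bounded: "bounded (range f)" by (auto simp: bounded_iff)
  have meas: "f \<in> borel_measurable \<mu>"
    using borel_measurable_continuous_onI[OF cont] by simp
  have int: "integrable \<mu> f"
    using bnd meas by (intro \<mu>.integrable_const_bound[of _ 1]) auto
  have esd0: "(LINT x|esd (walk_mat c n G). f x) = 0" if "n > 0" for n G
  proof -
    have "f x = 0" if "x \<in> set_pmf (esd (walk_mat c n G))" for x
      using esd_walk_mat(1)[OF c \<open>n > 0\<close>, of G] that by (force simp: f_def)
    then have "(LINT x|esd (walk_mat c n G). f x) = (LINT x|esd (walk_mat c n G). 0)"
      by (intro integral_cong_AE) (auto simp: AE_measure_pmf_iff)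
    then show ?thesis by simp
  qed
  have "(LINT x|\<mu>. f x) = 0"
  proof (rule ccontr)
    assume ne: "(LINT x|\<mu>. f x) \<noteq> 0"
    \<comment> \<open>The empirical integral is 0 for every graph, so the deviation always equals
      twice this \<open>\<epsilon>\<close>, and the event that should become improbable has
      probability 1.\<close>
    define \<epsilon> where "\<epsilon> = \<bar>LINT x|\<mu>. f x\<bar> / 2"
    have "\<epsilon> > 0" using ne by (simp add: \<epsilon>_def)
    then have "(\<lambda>n. measure_pmf.prob (erdos_renyi n (p / real n))
        {G. \<bar>(LINT x|esd (walk_mat c n G). f x) - (LINT x|\<mu>. f x)\<bar> > \<epsilon>}) \<longlonglongrightarrow> 0"
      using lim cont bounded unfolding limiting_esd_def weak_conv_in_prob_def by blast
    moreover have "eventually (\<lambda>n. measure_pmf.prob (erdos_renyi n (p / real n))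
        {G. \<bar>(LINT x|esd (walk_mat c n G). f x) - (LINT x|\<mu>. f x)\<bar> > \<epsilon>} = 1) sequentially"
      using eventually_gt_at_top[of 0]
    proof eventually_elim
      case (elim n)
      then have "{G. \<bar>(LINT x|esd (walk_mat c n G). f x) - (LINT x|\<mu>. f x)\<bar> > \<epsilon>} = UNIV"
        using ne by (auto simp: esd0 \<epsilon>_def)
      then show ?case by simp
    qed
    ultimately have "(\<lambda>n. 1 :: real) \<longlonglongrightarrow> 0" by (rule Lim_transform_eventually)
    then show False using LIMSEQ_unique[OF tendsto_const] by fastforce
  qed
  then have "AE x in \<mu>. f x = 0"
    by (subst (asm) integral_nonneg_eq_0_iff_AE[OF int]) (simp_all add: f_def)
  then show ?thesis by eventually_elim (auto simp: f_def min_def max_def split: if_splits)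
qed

lemma limiting_esd_moment:
  assumes c: "c > 0" and lim: "limiting_esd c p \<mu>"
  shows "integrable \<mu> (\<lambda>x. x ^ k)"
    and "(\<lambda>n. measure_pmf.expectation (erdos_renyi n (p / real n))
      (\<lambda>G. (\<Sum>i<n. (walk_mat c n G ^\<^sub>m k) $$ (i, i)) / real n)) \<longlonglongrightarrow> (LINT x|\<mu>. x ^ k)"
proof -
  interpret \<mu>: real_distribution \<mu> using lim by (simp add: limiting_esd_def)
  note supp = limiting_esd_support[OF c lim]
  have pow: "\<bar>x ^ k\<bar> \<le> 1" if "\<bar>x\<bar> \<le> 1" for x :: real
    using that by (simp add: power_abs power_le_one)
  have "AE x in \<mu>. norm (x ^ k) \<le> 1"
    using supp by eventually_elim (use pow in auto)
  then show "integrable \<mu> (\<lambda>x. x ^ k)" by (rule \<mu>.integrable_const_bound) simp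
  \<comment> \<open>Clamping to \<open>[-1, 1]\<close> before taking the power gives a bounded
    continuous function that agrees with \<open>x ^ k\<close> wherever \<open>\<mu>\<close> and the
    empirical distributions with \<open>n > 0\<close> have mass.\<close>
  define g :: "real \<Rightarrow> real" where "g x = (max (-1) (min 1 x)) ^ k" for x
  have cont: "continuous_on UNIV g" unfolding g_def by (intro continuous_intros)
  have bnd: "\<bar>g x\<bar> \<le> 1" for x unfolding g_def by (intro pow) auto
  then have bounded: "bounded (range g)" by (auto simp: bounded_iff)
  have meas: "g \<in> borel_measurable \<mu>"
    using borel_measurable_continuous_onI[OF cont] by simp
  have g_eq: "g x = x ^ k" if "\<bar>x\<bar> \<le> 1" for x using that by (auto simp: g_def min_def max_def)
  have \<mu>g: "(LINT x|\<mu>. g x) = (LINT x|\<mu>. x ^ k)"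
  proof (rule integral_cong_AE)
    show "AE x in \<mu>. g x = x ^ k" using supp by eventually_elim (rule g_eq)
  qed (use meas in auto)
  have esdg: "(LINT x|esd (walk_mat c n G). g x) = (\<Sum>i<n. (walk_mat c n G ^\<^sub>m k) $$ (i, i)) / real n"
    if "n > 0" for n G
  proof -
    have "(LINT x|esd (walk_mat c n G). g x) = (LINT x|esd (walk_mat c n G). x ^ k)"
      using esd_walk_mat(1)[OF c that, of G] 
      by (intro integral_cong_AE) (auto simp: AE_measure_pmf_iff abs_le_iff intro!: g_eq)
    then show ?thesis by (simp add: esd_walk_mat(2)[OF c that])
  qed
  \<comment> \<open>The bound is needed for every \<open>n\<close>, including 0; it uses only that
    \<open>esd\<close> yields a probability distribution.\<close>
  have "\<bar>LINT x|esd (walk_mat c n G). g x\<bar> \<le> 1" for n G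
  proof -
    have "\<bar>LINT x|esd (walk_mat c n G). g x\<bar> \<le> (LINT x|esd (walk_mat c n G). \<bar>g x\<bar>)"
      by (rule integral_abs_bound)
    also have "\<dots> \<le> (LINT x|esd (walk_mat c n G). 1)"
      using bnd by (intro integral_mono measure_pmf.integrable_const_bound[of _ 1]) auto
    finally show ?thesis by (simp add: measure_pmf.prob_space)
  qed
  then have "\<bar>(LINT x|esd (walk_mat c n G). g x) - (LINT x|\<mu>. g x)\<bar> \<le> 1 + \<bar>LINT x|\<mu>. g x\<bar>" for n G
    by (meson abs_triangle_ineq4 add_right_mono order_trans)
  then have "(\<lambda>n. measure_pmf.expectation (erdos_renyi n (p / real n))
      (\<lambda>G. LINT x|esd (walk_mat c n G). g x)) \<longlonglongrightarrow> (LINT x|\<mu>. g x)"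
    by (rule expectation_tendsto_if_prob_tendsto)
      (use lim cont bounded in \<open>auto simp: limiting_esd_def weak_conv_in_prob_def\<close>)
  moreover have "eventually (\<lambda>n. measure_pmf.expectation (erdos_renyi n (p / real n))
      (\<lambda>G. LINT x|esd (walk_mat c n G). g x) =
      measure_pmf.expectation (erdos_renyi n (p / real n))
      (\<lambda>G. (\<Sum>i<n. (walk_mat c n G ^\<^sub>m k) $$ (i, i)) / real n)) sequentially"
    using eventually_gt_at_top[of 0] by eventually_elim (simp add: esdg)
  ultimately show "(\<lambda>n. measure_pmf.expectation (erdos_renyi n (p / real n))
      (\<lambda>G. (\<Sum>i<n. (walk_mat c n G ^\<^sub>m k) $$ (i, i)) / real n)) \<longlonglongrightarrow> (LINT x|\<mu>. x ^ k)"
    unfolding \<mu>g by (rule Lim_transform_eventually)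
qed

text \<open>One sequence of expected normalised traces has both sides of the equation as its limit.
  Integrability is part of the claim because the integral of a nonintegrable function is 0 by
  convention, so the equation alone would not assert that the moment exists.\<close>

theorem proposition7:
  fixes c p :: real and \<mu> :: "real measure" and k m :: nat
  assumes "c > 0" and "p > 0"
    and "limiting_esd c p \<mu>"
    and "m \<ge> 1" and "k = 2 * m"
  shows "integrable \<mu> (\<lambda>x. x ^ k) \<and>
    (LINT x|\<mu>. x ^ k) =
      (\<Sum>t = 2..m + 1. p ^ (t - 1) *
        (\<Sum>i\<in>Gamma_paths k t. \<Prod>a = 1..t.
          measure_pmf.expectation (poisson_pmf p)
            (\<lambda>\<xi>. (c + real (degree_in a (path_graph i)) + real \<xi>) powi (- int (n_plus a i)))))"
  using LIMSEQ_unique[OF limiting_esd_moment(2)[OF assms(1,3)]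
      expected_trace_tendsto[OF assms(1,2,4,5)]] limiting_esd_moment(1)[OF assms(1,3), of k]
  by (simp add: vertex_factor_def[abs_def])

end
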